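(* Let $\epsilon_0>0$ and $\delta(\cdot),c(\cdot)$ be fixed as in the context. Given $0<\theta\le 1$ and $\gamma>0$, there exists $0<\epsilon<1$ (with $\epsilon<\epsilon_0$) so that for $x$ sufficiently large, if $N=N(\epsilon,x)$ is the LG set with parameters $\epsilon$, $c=c(\epsilon)$ and $x$ described in the context, then the following holds. Let $N_1$ be the set of $x^\theta$-smooth integers that lie in $N$ and are $<x^c$; let $N_2$ be the set of integers that are not $x^\theta$-smooth that lie in $N$ and are $<x^c$; let $w(n)\ge 0$ be some weighting function on the positive integers $n\le x$; and let $\sigma=\sum_{s\le x}w(s)$. Suppose that the following two inequalities hold: $$\sum_{q\in N_1}\ \sum_{s\le x,\ q\mid s}w(s)\;>\;(1-\gamma)\,\sigma\sum_{q\in N_1}\frac1q,\qquad\text{(A)}$$ $$\sum_{q\in N_2}\ \sum_{s\le x,\ q\mid s}w(s)\;>\;(1-\gamma)\,\sigma\sum_{q\in N_2}\frac1q.\qquad\text{(B)}$$ Then $$\left|\ \sum_{\substack{s\le x\\ s\text{ is }x^\theta\text{-smooth}}}w(s)\;-\;\sigma\sum_{q\in N_1}\frac1q\ \right|\;<\;2\gamma\sigma.$$ Moreover, if only (A) is assumed (and not (B)), then $$\sum_{\substack{s\le x\\ s\text{ is }x^\theta\text{-smooth}}}w(s)\;>\;(1-\gamma)\,\sigma\sum_{q\in N_1}\frac1q\;>\;(1-\gamma)\bigl(\rho(1/\theta)-2\epsilon\bigr)\sigma$$ for sufficiently large $x$.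
   Context: An integer is $y$-smooth if it has no prime divisor greater than $y$. $\Psi(x,y)$ denotes the number of $y$-smooth positive integers $\le x$, and Dickman's function is $\rho(u)=\lim_{x\to\infty}\Psi(x,x^{1/u})/x$ (the limit is known to exist). Definition (Local-Global set, abbreviated LG set). A set $N\subseteq\{2,3,\dots,x\}$ is an LG set with parameters $\epsilon$, $c$ and $x$ if and only if: (1) for any pair of distinct members $n_1,n_2\in N$ we have $\mathrm{lcm}(n_1,n_2)>x$; (2) all but at most $\epsilon x$ of the positive integers $m\le x$ are divisible by some $n\in N$ with $n\le x^c$. Fixed choice of LG sets. Fix $\epsilon_0>0$ and, for every $0<\epsilon<\epsilon_0$, constants $\delta=\delta(\epsilon)\in(0,1)$ and $c=c(\epsilon)\in(0,1)$ depending only on $\epsilon$, such that for all $x$ sufficiently large in terms of $\epsilon$ the following set $N=N(\epsilon,x)$ is an LG set with parameters $\epsilon$, $c$ and $x$: $N$ is the set of all integers $n\le x$ of the form $n=p_1p_2\cdots p_k$ ($k\ge1$ variable), where the $p_i$ are primes with $p_1>p_2>\cdots>p_k>x^\delta$, with $\frac{x}{p_1\cdots p_i}\ge p_i$ for $i=1,\dots,k-1$, and with $1\le\frac{x}{p_1\cdots p_k}<p_k$. (Such $\epsilon_0$, $\delta(\epsilon)$, $c(\epsilon)$ exist.)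
   Formalization: The final inequality of the "moreover" part, (1-γ)σΣ1/q > (1-γ)(ρ(1/θ)-2ε)σ, is asserted only for γ<1; for γ≥1 it is false as printed (e.g. θ=1, w=1, γ=1 gives 0>0). All other conclusions are for every γ>0. *)

theory Defs
  imports Complex_Main "HOL-Computational_Algebra.Primes"
begin

definition smooth :: "real \<Rightarrow> nat \<Rightarrow> bool" where
  "smooth y n \<longleftrightarrow> (\<forall>p. prime p \<and> p dvd n \<longrightarrow> real p \<le> y)"

definition pos_upto :: "real \<Rightarrow> nat set" where
  "pos_upto x = {n. 1 \<le> n \<and> real n \<le> x}"

definition Psi :: "real \<Rightarrow> real \<Rightarrow> nat" where
  "Psi x y = card {n \<in> pos_upto x. smooth y n}"

definition dickman_rho :: "real \<Rightarrow> real" where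
  "dickman_rho u = Lim at_top (\<lambda>x. real (Psi x (x powr (1 / u))) / x)"

definition LG_set :: "nat set \<Rightarrow> real \<Rightarrow> real \<Rightarrow> real \<Rightarrow> bool" where
  "LG_set N \<epsilon> c x \<longleftrightarrow>
     N \<subseteq> {n. 2 \<le> n \<and> real n \<le> x} \<and>
     (\<forall>n1\<in>N. \<forall>n2\<in>N. n1 \<noteq> n2 \<longrightarrow> real (lcm n1 n2) > x) \<and>
     real (card {m \<in> pos_upto x. \<not> (\<exists>n\<in>N. real n \<le> x powr c \<and> n dvd m)}) \<le> \<epsilon> * x"

text \<open>
  The list \<open>ps\<close> is \<open>p\<^sub>1 > p\<^sub>2 > \<dots> > p\<^sub>k\<close>, so \<open>p\<^sub>i\<close> is \<open>ps ! (i - 1)\<close> and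
  \<open>p\<^sub>1 \<cdots> p\<^sub>i\<close> is \<open>prod_list (take i ps)\<close>.
\<close>

definition LG_N :: "real \<Rightarrow> real \<Rightarrow> nat set" where
  "LG_N \<delta> x = {n. real n \<le> x \<and>
     (\<exists>ps. ps \<noteq> [] \<and> n = prod_list ps \<and>
        (\<forall>p\<in>set ps. prime p) \<and> sorted_wrt (>) ps \<and> real (last ps) > x powr \<delta> \<and>
        (\<forall>i\<in>{1..<length ps}. x / real (prod_list (take i ps)) \<ge> real (ps ! (i - 1))) \<and>
        1 \<le> x / real (prod_list ps) \<and> x / real (prod_list ps) < real (last ps))}"

end

theory Submission
  imports Defs "HOL-Number_Theory.Prime_Powers" "HOL-Analysis.Summation_Tests"
begin

text \<open>
  If \<open>q\<close> lies in the LG set and \<open>q dvd s \<le> x\<close>, then \<open>s / q\<close> is smaller than the least prime factor of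
  \<open>q\<close>, so \<open>s\<close> is \<open>x powr \<theta>\<close>-smooth iff \<open>q\<close> is. Since each \<open>s \<le> x\<close> is divisible by at most one \<open>q\<close>,
  the sums in (A) and (B) are the weights of disjoint sets of smooth and non-smooth integers. Counting
  integers instead of weights shows that the reciprocals of \<open>N1 \<union> N2\<close> sum to \<open>1 + O(\<epsilon>) + o(1)\<close> and
  those of \<open>N1\<close> to at least \<open>\<rho>(1 / \<theta>) - \<epsilon> - o(1)\<close>.

  As \<open>dickman_rho\<close> is a \<open>Lim\<close>, this needs the convergence of \<open>Psi x (x powr t) / x\<close>. By Buchstab's
  identity this density equals \<open>\<lfloor>x\<rfloor> / x - (\<Sum>p. Psi (x / p) p) / x\<close> over the primes \<open>x powr t < p \<le> x\<close>;
  by Mertens' first theorem the masses \<open>ln p / (p * ln x)\<close> at \<open>ln p / ln x\<close> become uniform on \<open>[0, 1]\<close>,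
  and induction on \<open>k\<close> with \<open>t \<ge> 1 / k\<close> applies because \<open>t / (1 - t) \<ge> 1 / (k - 1)\<close>.
\<close>

subsection \<open>Mertens' first theorem\<close>

text \<open>Legendre's formula by induction: from \<open>n\<close> to \<open>Suc n\<close> the
  quotient by \<open>d\<close> grows exactly when \<open>d\<close> divides \<open>Suc n\<close>, and
  the Mangoldt values of these divisors add up to \<open>ln (Suc n)\<close>. The free bound
  \<open>M\<close> lets \<open>fact n\<close> and \<open>fact (2*n)\<close> be expanded over one
  index range.\<close>

lemma ln_fact_eq_sum_mangoldt:
  assumes "n \<le> M"
  shows "ln (fact n) = (\<Sum>d\<in>{1..M}. mangoldt d * real (n div d))"
  using assms
proof (induction n)
  case (Suc n)
  have "(\<Sum>d\<in>{1..M}. mangoldt d * real (Suc n div d)) =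
      (\<Sum>d\<in>{1..M}. mangoldt d * real (n div d) + (if d dvd Suc n then mangoldt d else 0))"
    by (intro sum.cong) (auto simp: div_Suc dvd_eq_mod_eq_0 algebra_simps)
  also have "\<dots> = ln (fact n) + (\<Sum>d\<in>{1..M}. if d dvd Suc n then mangoldt d else 0)"
    using Suc by (simp add: sum.distrib)
  also have "(\<Sum>d\<in>{1..M}. if d dvd Suc n then mangoldt d else 0) = (\<Sum>d | d dvd Suc n. mangoldt d :: real)"
  proof (intro sum.mono_neutral_cong_right)
    show "{d. d dvd Suc n} \<subseteq> {1..M}"
    proof
      fix d assume "d \<in> {d. d dvd Suc n}"
      hence "d > 0" "d \<le> Suc n" using dvd_pos_nat[of "Suc n" d] by (auto dest: dvd_imp_le)
      thus "d \<in> {1..M}" using Suc.prems by simp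
    qed
  qed auto
  also have "\<dots> = ln (real (Suc n))"
    using mangoldt_sum[of "Suc n", where 'a = real] by simp
  also have "ln (fact n) + \<dots> = ln (fact (Suc n))"
    by (simp add: ln_mult del: of_nat_Suc)
  finally show ?case ..
qed simp

lemma ln_fact_ge: "ln (fact n) \<ge> real n * ln (real n) - real n"
proof (cases "n = 0")
  case False
  \<comment> \<open>The left side is a single term of the exponential series at
    \<open>n\<close>.\<close>
  have "real n ^ n / fact n \<le> exp (real n)"
  proof -
    have "(\<lambda>k. real n ^ k / fact k) sums exp (real n)"
      using exp_converges[of "real n"] by (simp add: divide_inverse mult.commute)
    moreover from this have "(\<Sum>k\<in>{n}. real n ^ k / fact k) \<le> exp (real n)"
      by (metis (no_types, lifting) divide_nonneg_pos fact_gt_zero finite.emptyI finite.insertI of_nat_0_le_iff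
          sum_le_suminf sums_iff zero_le_power)
    ultimately show ?thesis by simp
  qed
  hence "ln (real n ^ n / fact n) \<le> real n"
    using False by (subst ln_exp [symmetric], subst ln_le_cancel_iff) auto
  thus ?thesis using False by (simp add: ln_div ln_realpow)
qed simp

lemma ln_fact_le: "ln (fact n) \<le> real n * ln (real n)"
proof (cases "n = 0")
  case False
  have "(fact n :: real) \<le> real n ^ n"
    using fact_le_power[of n] by simp
  hence "ln (fact n) \<le> ln (real n ^ n)" using False by (subst ln_le_cancel_iff) auto
  thus ?thesis using False by (simp add: ln_realpow)
qed simp

text \<open>Chebyshev's argument. The coefficient \<open>2*n div d - 2 * (n div d)\<close> is
  nonnegative and at least 1 for \<open>n < d \<le> 2*n\<close>, while the Mangoldt sum with these
  coefficients is the logarithm of the central binomial coefficient, at most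
  \<open>2 ^ (2*n)\<close>.\<close>

lemma sum_mangoldt_double:
  "(\<Sum>d\<in>{1..2*n}. mangoldt d :: real) \<le> (\<Sum>d\<in>{1..n}. mangoldt d) + 2 * real n * ln 2"
proof -
  have "(\<Sum>d\<in>{1..2*n}. mangoldt d :: real) - (\<Sum>d\<in>{1..n}. mangoldt d) = (\<Sum>d\<in>{n<..2*n}. mangoldt d)"
    by (subst sum_diff [symmetric]) (auto intro!: sum.cong)
  also have "\<dots> \<le> (\<Sum>d\<in>{n<..2*n}. mangoldt d * (real (2*n div d) - 2 * real (n div d)))"
  proof (intro sum_mono)
    fix d assume d: "d \<in> {n<..2*n}"
    hence "2 * n div d \<ge> 1" "n div d = 0" by (auto simp: Suc_le_eq div_greater_zero_iff)
    thus "(mangoldt d :: real) \<le> mangoldt d * (real (2*n div d) - 2 * real (n div d))"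
      using mult_left_mono[of 1 "real (2*n div d)" "mangoldt d :: real"] by (simp add: mangoldt_nonneg)
  qed
  also have "\<dots> \<le> (\<Sum>d\<in>{1..2*n}. mangoldt d * (real (2*n div d) - 2 * real (n div d)))"
  proof (intro sum_mono2)
    fix d
    have "2 * (n div d) \<le> 2 * n div d"
      using less_eq_div_iff_mult_less_eq[of d "2 * (n div d)" "2 * n"] div_times_less_eq_dividend[of n d]
      by (cases "d = 0") auto
    thus "(mangoldt d :: real) * (real (2*n div d) - 2 * real (n div d)) \<ge> 0"
      by (intro mult_nonneg_nonneg mangoldt_nonneg) linarith
  qed auto
  also have "\<dots> = ln (fact (2*n)) - 2 * ln (fact n)"
    by (simp add: ln_fact_eq_sum_mangoldt[of _ "2*n"] sum_subtractf sum_distrib_left algebra_simps)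
  also have "\<dots> = ln (real (2*n choose n))"
  proof -
    have "real (2*n choose n) = fact (2*n) / (fact n * fact n)"
      using binomial_fact[of n "2*n", where 'a = real] by simp
    hence "ln (real (2*n choose n)) = ln (fact (2*n)) - (ln (fact n) + ln (fact n))"
      by (simp only: ln_div ln_mult fact_nonzero mult_eq_0_iff simp_thms if_True)
    thus ?thesis by simp
  qed
  also have "\<dots> \<le> ln (2 ^ (2*n))"
  proof (subst ln_le_cancel_iff)
    show "real (2*n choose n) \<le> 2 ^ (2*n)"
      using binomial_le_pow2[of "2*n" n] by (metis of_nat_le_iff of_nat_numeral of_nat_power)
  qed simp_all
  also have "\<dots> = 2 * real n * ln 2" by (simp add: ln_realpow)
  finally show ?thesis by simp
qed

text \<open>Halving reduces \<open>n = 2*m\<close> to \<open>6*m \<le> 4*n\<close>. An odd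
  \<open>n = 2*m + 1\<close> is rounded up to \<open>2*(m+1)\<close>, and
  \<open>6*(m+1) \<le> 4*n\<close> holds once \<open>m \<ge> 1\<close>, which is why
  \<open>n \<le> 1\<close> is split off.\<close>

lemma sum_mangoldt_le: "(\<Sum>d\<in>{1..n}. mangoldt d :: real) \<le> 4 * real n"
proof (induction n rule: less_induct)
  case (less n)
  consider "n \<le> 1" | m where "n = 2 * m" "m \<ge> 1" | m where "n = 2 * m + 1" "m \<ge> 1"
    by (metis One_nat_def add.commute dvd_def even_Suc gr0I less_eq_Suc_le mult_0_right not_less oddE plus_1_eq_Suc zero_le)
  thus ?case
  proof cases
    case 1
    thus ?thesis by (cases n) auto
  next
    case (2 m)
    have "(\<Sum>d\<in>{1..n}. mangoldt d :: real) \<le> 4 * real m + 2 * real m * ln 2"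
      using sum_mangoldt_double[of m] less[of m] 2 by simp
    moreover have "real m * ln 2 \<le> real m * 1" using ln_2_less_1 by (intro mult_left_mono) auto
    ultimately have "(\<Sum>d\<in>{1..n}. mangoldt d :: real) \<le> 6 * real m" by linarith
    thus ?thesis using 2 by simp
  next
    case (3 m)
    have "(\<Sum>d\<in>{1..n}. mangoldt d :: real) \<le> (\<Sum>d\<in>{1..2*(m+1)}. mangoldt d)"
      using 3 by (intro sum_mono2) (auto simp: mangoldt_nonneg)
    also have "\<dots> \<le> 4 * real (m+1) + 2 * real (m+1) * ln 2"
      using sum_mangoldt_double[of "m+1"] less[of "m+1"] 3 by simp
    also have "\<dots> \<le> 4 * real (m+1) + 2 * real (m+1) * 1"
      using ln_2_less_1 by (intro add_mono mult_left_mono) auto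
    finally show ?thesis using 3 by simp
  qed
qed

text \<open>Both sides are compared with \<open>ln (fact n)\<close> after multiplication by
  \<open>n\<close>. Replacing \<open>n div d\<close> by \<open>n / d\<close> costs at most
  \<open>mangoldt d\<close> for each \<open>d\<close>, hence at most \<open>4 * n\<close> in total
  by Chebyshev's bound.\<close>

lemma sum_mangoldt_over_bounds:
  assumes "n \<ge> 1"
  shows "\<bar>(\<Sum>d\<in>{1..n}. mangoldt d / real d) - ln (real n)\<bar> \<le> 4"
proof -
  let ?M = "\<Sum>d\<in>{1..n}. mangoldt d / real d"
  have "real n * ln (real n) - real n \<le> (\<Sum>d\<in>{1..n}. mangoldt d * real (n div d))"
    using ln_fact_ge[of n] ln_fact_eq_sum_mangoldt[of n n] by simp
  also have "\<dots> \<le> (\<Sum>d\<in>{1..n}. mangoldt d * (real n / real d))"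
    by (intro sum_mono mult_left_mono mangoldt_nonneg) (simp add: of_nat_div_le_of_nat)
  also have "\<dots> = real n * ?M" by (simp add: sum_distrib_left mult_ac)
  finally have "real n * (ln (real n) - 1) \<le> real n * ?M" by (simp add: algebra_simps)
  hence 1: "ln (real n) - 1 \<le> ?M" using assms by simp
  have "real n * ?M - 4 * real n \<le> real n * ?M - (\<Sum>d\<in>{1..n}. mangoldt d)"
    using sum_mangoldt_le[of n] by simp
  also have "\<dots> = (\<Sum>d\<in>{1..n}. mangoldt d * (real n / real d - 1))"
    by (simp add: sum_distrib_left mult_ac algebra_simps sum_subtractf)
  also have "\<dots> \<le> (\<Sum>d\<in>{1..n}. mangoldt d * real (n div d))"
  proof (intro sum_mono mult_left_mono mangoldt_nonneg)
    fix d
    show "real n / real d - 1 \<le> real (n div d)"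
      using real_of_int_div3[of "int n" "int d"] by (simp add: zdiv_int [symmetric])
  qed
  also have "\<dots> \<le> real n * ln (real n)"
    using ln_fact_le[of n] ln_fact_eq_sum_mangoldt[of n n] by simp
  finally have "real n * (?M - 4) \<le> real n * ln (real n)" by (simp add: algebra_simps)
  hence "?M - 4 \<le> ln (real n)" using assms by simp
  with 1 show ?thesis by linarith
qed

section \<open>Contribution of proper prime powers\<close>

text \<open>The subtracted power makes the geometric bound inductive; at \<open>r = 1/2\<close> it
  is an equality.\<close>

lemma sum_powers_ge_two_le:
  fixes r :: real
  assumes "0 \<le> r" "r \<le> 1/2" "n \<ge> 1"
  shows "(\<Sum>k\<in>{2..n}. r ^ k) \<le> 2 * r\<^sup>2 - 2 * r ^ (n + 1)"
  using assms(3)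
proof (induction n rule: dec_induct)
  case base
  thus ?case by (simp add: power2_eq_square)
next
  case (step n)
  have "r * r ^ (n+1) \<le> (1/2) * r ^ (n+1)" using assms by (intro mult_right_mono) auto
  moreover have "{2..Suc n} = insert (Suc n) {2..n}" using step by auto
  ultimately show ?case using step by simp
qed

text \<open>The powers of \<open>p\<close> with exponent at least 2 contribute at most
  \<open>2 * ln p / p^2\<close>, and \<open>ln p \<le> 2 * p powr (1/2)\<close> turns this into a
  term of a convergent series.\<close>

lemma sum_proper_prime_powers_bounded:
  "\<exists>C. \<forall>n. (\<Sum>d\<in>{d\<in>{1..n}. \<not> prime d}. mangoldt d / real d) \<le> C"
proof -
  define C where "C = (\<Sum>p. 4 * (real p powr (-3/2)))"
  have summable: "summable (\<lambda>p. 4 * (real p powr (-3/2)))"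
    by (intro summable_mult) (simp add: summable_real_powr_iff)
  have "(\<Sum>d\<in>{d\<in>{1..n}. \<not> prime d}. mangoldt d / real d) \<le> C" for n
  proof -
    \<comment> \<open>Exponents up to \<open>n\<close> suffice, since
      \<open>k < 2 ^ k \<le> p ^ k \<le> n\<close>.\<close>
    define A where "A = {p\<in>{2..n}. prime p} \<times> {2..n}"
    define f where "f = (\<lambda>(p,k). p ^ k :: nat)"
    have sub: "{d\<in>{1..n}. primepow d \<and> \<not> prime d} \<subseteq> f ` A"
    proof
      fix d assume "d \<in> {d\<in>{1..n}. primepow d \<and> \<not> prime d}"
      then obtain p k where d: "prime p" "k > 0" "d = p ^ k" "\<not> prime d" "d \<le> n"
        by (auto simp: primepow_def)
      have "k \<ge> 2" using d by (cases "k = 1") auto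
      have p2: "p \<ge> 2" using d(1) by (rule prime_ge_2_nat)
      have "k < 2 ^ k" by simp
      also have "2 ^ k \<le> p ^ k" using p2 by (intro power_mono) auto
      finally have "k \<le> n" using d by simp
      moreover have "p \<le> p ^ k" using p2 d(2) by (intro self_le_power) auto
      ultimately have "(p, k) \<in> A" using d p2 \<open>k \<ge> 2\<close> by (auto simp: A_def)
      thus "d \<in> f ` A" using d(3) by (force simp: f_def)
    qed
    have "(\<Sum>d\<in>{d\<in>{1..n}. \<not> prime d}. mangoldt d / real d) =
        (\<Sum>d\<in>{d\<in>{1..n}. primepow d \<and> \<not> prime d}. mangoldt d / real d :: real)"
      by (intro sum.mono_neutral_right) (auto simp: mangoldt_def)
    also have "\<dots> \<le> (\<Sum>d\<in>f ` A. mangoldt d / real d)"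
      using sub by (intro sum_mono2) (auto simp: A_def mangoldt_nonneg)
    also have "\<dots> \<le> (\<Sum>x\<in>A. ((\<lambda>d. mangoldt d / real d) \<circ> f) x)"
      by (intro sum_image_le) (auto simp: A_def mangoldt_nonneg)
    also have "\<dots> = (\<Sum>p\<in>{p\<in>{2..n}. prime p}. \<Sum>k\<in>{2..n}. ln (real p) * (1 / real p) ^ k)"
      unfolding A_def
      by (subst sum.cartesian_product) (auto intro!: sum.cong simp: f_def power_one_over)
    also have "\<dots> \<le> (\<Sum>p\<in>{p\<in>{2..n}. prime p}. 4 * (real p powr (-3/2)))"
    proof (intro sum_mono)
      fix p assume p: "p \<in> {p\<in>{2..n}. prime p}"
      have "(\<Sum>k\<in>{2..n}. (1 / real p) ^ k) \<le> 2 * (1 / real p)\<^sup>2 - 2 * (1 / real p) ^ (n + 1)"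
        using p by (intro sum_powers_ge_two_le) (auto simp: field_simps)
      also have "\<dots> \<le> 2 * (1 / real p)\<^sup>2" by simp
      finally have 1: "(\<Sum>k\<in>{2..n}. (1 / real p) ^ k) \<le> 2 * (1 / real p)\<^sup>2" .
      have "ln (real p) = 2 * ln (real p powr (1/2))" using p by (simp add: ln_powr)
      also have "\<dots> \<le> 2 * (real p powr (1/2))"
        using p ln_le_minus_one[of "real p powr (1/2)"] by simp
      finally have 2: "ln (real p) \<le> 2 * (real p powr (1/2))" .
      have "(\<Sum>k\<in>{2..n}. ln (real p) * (1 / real p) ^ k) = ln (real p) * (\<Sum>k\<in>{2..n}. (1 / real p) ^ k)"
        by (simp add: sum_distrib_left)
      also have "\<dots> \<le> (2 * (real p powr (1/2))) * (2 * (1 / real p)\<^sup>2)"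
        using p by (intro mult_mono 1 2 sum_nonneg) auto
      also have "(1 / real p)\<^sup>2 = real p powr (-2)"
        using p by (simp add: powr_minus powr_numeral field_simps)
      also have "(2 * (real p powr (1/2))) * (2 * real p powr (-2)) = 4 * (real p powr (-3/2))"
        by (simp add: powr_add [symmetric])
      finally show "(\<Sum>k\<in>{2..n}. ln (real p) * (1 / real p) ^ k) \<le> 4 * (real p powr (-3/2))" .
    qed
    also have "\<dots> \<le> C"
      unfolding C_def by (intro sum_le_suminf summable) auto
    finally show ?thesis .
  qed
  thus ?thesis by blast
qed

text \<open>Open on the left, so that adjacent ranges are disjoint and the primes above
  \<open>y\<close> are exactly those that violate \<open>y\<close>-smoothness.\<close>

definition primes_in :: "real \<Rightarrow> real \<Rightarrow> nat set" where
  "primes_in y z = {p. prime p \<and> y < real p \<and> real p \<le> z}"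

lemma finite_primes_in [simp, intro]: "finite (primes_in y z)"
  by (rule finite_subset[of _ "{..nat \<lfloor>z\<rfloor>}"]) (auto simp: primes_in_def le_nat_floor)

lemma mertens_first:
  "\<exists>C. \<forall>x\<ge>1. \<bar>(\<Sum>p\<in>primes_in 0 x. ln (real p) / real p) - ln x\<bar> \<le> C"
proof -
  obtain C where C: "\<And>n. (\<Sum>d\<in>{d\<in>{1..n}. \<not> prime d}. mangoldt d / real d) \<le> C"
    using sum_proper_prime_powers_bounded by auto
  \<comment> \<open>\<open>C\<close> pays for the proper prime powers, 4 for the Mangoldt sum, and 1
    for replacing \<open>x\<close> by its floor inside the logarithm.\<close>
  have "\<bar>(\<Sum>p\<in>primes_in 0 x. ln (real p) / real p) - ln x\<bar> \<le> C + 5" if x: "x \<ge> 1" for x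
  proof -
    define n where "n = nat \<lfloor>x\<rfloor>"
    have n: "n \<ge> 1" "real n \<le> x" "x \<le> real n + 1"
      using x by (auto simp: n_def le_nat_iff)
    have eq: "primes_in 0 x = {d\<in>{1..n}. prime d}"
      using n(2) by (force simp: primes_in_def n_def le_nat_floor prime_gt_0_nat Suc_le_eq)
    let ?R = "\<Sum>d\<in>{d\<in>{1..n}. \<not> prime d}. mangoldt d / real d :: real"
    have "(\<Sum>d\<in>{1..n}. mangoldt d / real d) = (\<Sum>d\<in>{d\<in>{1..n}. prime d}. mangoldt d / real d) + ?R"
      by (subst sum.union_disjoint [symmetric]) (auto intro!: sum.cong)
    also have "(\<Sum>d\<in>{d\<in>{1..n}. prime d}. mangoldt d / real d) = (\<Sum>p\<in>primes_in 0 x. ln (real p) / real p)"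
      unfolding eq by (intro sum.cong) auto
    finally have "(\<Sum>d\<in>{1..n}. mangoldt d / real d) = (\<Sum>p\<in>primes_in 0 x. ln (real p) / real p) + ?R" .
    moreover have "?R \<ge> 0" by (intro sum_nonneg) (auto simp: mangoldt_nonneg)
    moreover have "ln (real n) \<le> ln x" using n x by (subst ln_le_cancel_iff) auto
    moreover have "ln x \<le> ln (real n) + 1"
    proof -
      have "ln x - ln (real n) = ln (x / real n)" using n x by (simp add: ln_div)
      also have "\<dots> \<le> x / real n - 1" using n x by (intro ln_le_minus_one) auto
      also have "\<dots> \<le> 1" using n by (simp add: field_simps)
      finally show ?thesis by simp
    qed
    ultimately show ?thesis using sum_mangoldt_over_bounds[OF n(1)] C[of n] by linarith
  qed
  thus ?thesis by blast
qed

subsection \<open>Existence of the Dickman limit\<close>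

lemma finite_pos_upto [simp, intro]: "finite (pos_upto x)"
  by (rule finite_subset[of _ "{..nat \<lfloor>x\<rfloor>}"]) (auto simp: pos_upto_def le_nat_floor)

lemma card_pos_upto: "x \<ge> 0 \<Longrightarrow> real (card (pos_upto x)) = of_int \<lfloor>x\<rfloor>"
proof -
  assume x: "x \<ge> 0"
  have "pos_upto x = {1..nat \<lfloor>x\<rfloor>}"
    using x by (auto simp: pos_upto_def le_nat_floor le_nat_iff le_floor_iff)
  thus ?thesis using x by simp
qed

lemma Psi_mono: "y \<le> y' \<Longrightarrow> Psi x y \<le> Psi x y'"
  unfolding Psi_def smooth_def by (intro card_mono) (auto intro: order_trans)

lemma Psi_le: "x \<ge> 0 \<Longrightarrow> real (Psi x y) \<le> x"
proof -
  assume x: "x \<ge> 0"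
  have "Psi x y \<le> card (pos_upto x)" unfolding Psi_def by (intro card_mono) auto
  hence "real (Psi x y) \<le> real (card (pos_upto x))" by simp
  also have "\<dots> \<le> x" using card_pos_upto[OF x] by simp
  finally show ?thesis .
qed

section \<open>Buchstab's identity\<close>

lemma not_smooth_decompose:
  assumes "\<not> smooth y n" "n > 0"
  shows "\<exists>p m. prime p \<and> y < real p \<and> n = p * m \<and> smooth (real p) m"
proof -
  \<comment> \<open>Removing one copy of the largest prime factor leaves no prime above
    \<open>p\<close>; \<open>p\<close> itself may recur.\<close>
  define p where "p = Max (prime_factors n)"
  obtain q where q: "prime q" "q dvd n" "y < real q"
    using assms by (auto simp: smooth_def not_le)
  hence ne: "q \<in> prime_factors n" using assms by (auto simp: prime_factors_dvd)
  hence "p \<in> prime_factors n" unfolding p_def by (intro Max_in) auto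
  hence p: "prime p" "p dvd n" by auto
  have max: "r \<le> p" if "prime r" "r dvd n" for r
    unfolding p_def using that assms by (intro Max_ge) (auto simp: prime_factors_dvd)
  obtain m where m: "n = p * m" using p by (elim dvdE)
  have "smooth (real p) m" unfolding smooth_def using max m by auto
  moreover have "y < real p" using max[OF q(1,2)] q(3) by linarith
  ultimately show ?thesis using p m by blast
qed

text \<open>The integers that are not \<open>y\<close>-smooth are sorted by their largest prime
  factor \<open>p\<close>. The cofactor then ranges over the \<open>p\<close>-smooth integers up to
  \<open>x / p\<close>.\<close>

lemma buchstab:
  assumes "x \<ge> 0"
  shows "card (pos_upto x) = Psi x y + (\<Sum>p\<in>primes_in y x. Psi (x / real p) (real p))"
proof -
  define B where "B p = (\<lambda>m. p * m) ` {m \<in> pos_upto (x / real p). smooth (real p) m}" for p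
  have eq: "pos_upto x = {n \<in> pos_upto x. smooth y n} \<union> (\<Union>p\<in>primes_in y x. B p)" (is "?L = ?R")
  proof (intro equalityI subsetI)
    fix n assume n: "n \<in> ?L"
    show "n \<in> ?R"
    proof (cases "smooth y n")
      case False
      have n': "n > 0" "real n \<le> x" using n by (auto simp: pos_upto_def)
      obtain p m where p: "prime p" "y < real p" "n = p * m" "smooth (real p) m"
        using not_smooth_decompose[OF False n'(1)] by blast
      have "m > 0" "p > 0" using p n' by auto
      hence "real p * 1 \<le> real p * real m" by (intro mult_left_mono) auto
      hence "real p \<le> real n" using p(3) by simp
      hence "real p \<le> x" using n' by linarith
      moreover have "m \<in> pos_upto (x / real p)"
        using \<open>m > 0\<close> \<open>p > 0\<close> n' p(3) by (auto simp: pos_upto_def field_simps)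
      ultimately show ?thesis using p by (auto simp: primes_in_def B_def)
    qed (use n in auto)
  next
    fix n assume "n \<in> ?R"
    thus "n \<in> ?L"
      by (auto simp: B_def pos_upto_def primes_in_def field_simps Suc_le_eq prime_gt_0_nat)
  qed
  have disj: "{n \<in> pos_upto x. smooth y n} \<inter> (\<Union>p\<in>primes_in y x. B p) = {}"
    by (auto simp: B_def primes_in_def smooth_def not_le)
  have disj2: "B p \<inter> B q = {}" if "p \<in> primes_in y x" "q \<in> primes_in y x" "p \<noteq> q" for p q
  proof -
    \<comment> \<open>For \<open>p < q\<close>, the prime \<open>q\<close> would divide a number all
      of whose prime factors are at most \<open>p\<close>.\<close>
    have *: False if "prime p" "prime q" "p < q" "p * m = q * k" "smooth (real p) m" for p q m k :: nat
    proof -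
      have "q dvd p * m" using that by simp
      hence "q dvd p \<or> q dvd m" using \<open>prime q\<close> by (rule prime_dvd_multD [rotated])
      thus False using that primes_dvd_imp_eq[of q p] by (auto simp: smooth_def)
    qed
    show ?thesis
    proof (cases "p < q")
      case True
      thus ?thesis using that *[of p q] by (auto simp: B_def primes_in_def)
    next
      case False
      hence "q < p" using that by simp
      thus ?thesis using that *[of q p] by (auto simp: B_def primes_in_def) metis
    qed
  qed
  have "card (B p) = Psi (x / real p) (real p)" if "p \<in> primes_in y x" for p
    unfolding B_def Psi_def
    using that by (intro card_image) (auto simp: inj_on_def primes_in_def)
  hence "card (\<Union>p\<in>primes_in y x. B p) = (\<Sum>p\<in>primes_in y x. Psi (x / real p) (real p))"
    using disj2 by (subst card_UN_disjoint) (auto simp: B_def)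
  thus ?thesis
    by (subst eq, subst card_Un_disjoint) (use disj in \<open>auto simp: Psi_def B_def\<close>)
qed

lemma primes_in_union:
  assumes "a \<le> b" "b \<le> c"
  shows "primes_in a c = primes_in a b \<union> primes_in b c" "primes_in a b \<inter> primes_in b c = {}"
  using assms by (auto simp: primes_in_def)

lemma sum_primes_in_split:
  assumes "a \<le> b" "b \<le> c"
  shows "sum f (primes_in a c) = sum f (primes_in a b) + sum f (primes_in b c)"
  using primes_in_union[OF assms] by (metis finite_primes_in sum.union_disjoint)

section \<open>Distribution of primes on the logarithmic scale\<close>

definition prime_log_density :: "real \<Rightarrow> real \<Rightarrow> real \<Rightarrow> real" where
  "prime_log_density a b x = (\<Sum>p\<in>primes_in (x powr a) (x powr b). ln (real p) / real p) / ln x"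

text \<open>Subtracting Mertens' estimates at \<open>x powr a\<close> and \<open>x powr b\<close>
  leaves an error of at most \<open>2 * C\<close>, which division by \<open>ln x\<close> sends to
  0.\<close>

lemma prime_log_density_tendsto:
  assumes "0 \<le> a" "a \<le> b"
  shows "(prime_log_density a b \<longlongrightarrow> b - a) at_top"
proof -
  obtain C where C: "\<And>x. x \<ge> 1 \<Longrightarrow> \<bar>(\<Sum>p\<in>primes_in 0 x. ln (real p) / real p) - ln x\<bar> \<le> C"
    using mertens_first by blast
  have bound: "\<bar>prime_log_density a b x - (b - a)\<bar> \<le> 2 * C * inverse (ln x)" if x: "x > 1" for x
  proof -
    define S where "S = (\<Sum>p\<in>primes_in (x powr a) (x powr b). ln (real p) / real p)"
    have le: "x powr a \<le> x powr b" using x assms by (intro powr_mono) auto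
    have "x powr a \<ge> 1" "x powr b \<ge> 1" using x assms by (auto intro!: ge_one_powr_ge_zero)
    note C2 = C[OF this(1)] C[OF this(2)]
    have "x \<noteq> 0" using x by simp
    hence "ln (x powr a) = a * ln x" "ln (x powr b) = b * ln x" by (simp_all add: ln_powr)
    moreover have "(\<Sum>p\<in>primes_in 0 (x powr b). ln (real p) / real p) =
        (\<Sum>p\<in>primes_in 0 (x powr a). ln (real p) / real p) + S"
      unfolding S_def using le by (intro sum_primes_in_split) auto
    moreover have "(b - a) * ln x = b * ln x - a * ln x" by (simp add: algebra_simps)
    ultimately have "\<bar>S - (b - a) * ln x\<bar> \<le> 2 * C" using C2 by linarith
    hence "\<bar>S - (b - a) * ln x\<bar> / ln x \<le> 2 * C / ln x"
      using x by (intro divide_right_mono) auto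
    also have "\<bar>S - (b - a) * ln x\<bar> / ln x = \<bar>(S - (b - a) * ln x) / ln x\<bar>"
      using x by simp
    also have "(S - (b - a) * ln x) / ln x = prime_log_density a b x - (b - a)"
      using x by (simp add: prime_log_density_def S_def field_simps)
    finally show ?thesis by (simp add: field_simps)
  qed
  have "((\<lambda>x. 2 * C * inverse (ln x)) \<longlongrightarrow> 2 * C * 0) at_top"
    by (intro tendsto_mult tendsto_const tendsto_inverse_0_at_top ln_at_top)
  hence lim: "((\<lambda>x. 2 * C * inverse (ln x)) \<longlongrightarrow> 0) at_top" by simp
  have "\<forall>\<^sub>F x in at_top. norm (prime_log_density a b x - (b - a)) \<le> 2 * C * inverse (ln x)"
    using eventually_gt_at_top[of 1] by eventually_elim (use bound in simp)
  from this lim have "((\<lambda>x. prime_log_density a b x - (b - a)) \<longlongrightarrow> 0) at_top"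
    by (rule Lim_null_comparison)
  thus ?thesis by (simp add: LIM_zero_iff)
qed

text \<open>Cauchy's criterion. As \<open>l\<close> may depend on \<open>e\<close>, convergence
  follows from finite Riemann sums without identifying the limit as an integral.\<close>

lemma convergent_if_approximable:
  fixes f :: "'a \<Rightarrow> real"
  assumes "F \<noteq> bot" and "\<And>e. e > 0 \<Longrightarrow> \<exists>l. \<forall>\<^sub>F x in F. \<bar>f x - l\<bar> \<le> e"
  shows "\<exists>L. (f \<longlongrightarrow> L) F"
proof -
  have "cauchy_filter (filtermap f F)"
    unfolding cauchy_filter_metric_filtermap
  proof (intro allI impI)
    fix e :: real assume "e > 0"
    then obtain l where l: "\<forall>\<^sub>F x in F. \<bar>f x - l\<bar> \<le> e / 3" using assms(2)[of "e/3"] by auto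
    show "\<exists>P. eventually P F \<and> (\<forall>x y. P x \<and> P y \<longrightarrow> dist (f x) (f y) < e)"
    proof (intro exI conjI allI impI)
      fix x y assume "\<bar>f x - l\<bar> \<le> e / 3 \<and> \<bar>f y - l\<bar> \<le> e / 3"
      thus "dist (f x) (f y) < e" unfolding dist_real_def using \<open>e > 0\<close> by linarith
    qed (rule l)
  qed
  then obtain L where "filtermap f F \<le> nhds L"
    using cauchy_filter_complete_converges[of "filtermap f F" UNIV] assms(1)
    by (auto simp: complete_UNIV filtermap_bot_iff)
  thus ?thesis by (auto simp: filterlim_def)
qed

section \<open>Densities of smooth integers and Buchstab sums\<close>

definition smooth_density :: "real \<Rightarrow> real \<Rightarrow> real" where
  "smooth_density t x = real (Psi x (x powr t)) / x"

lemma smooth_density_nonneg: "x \<ge> 0 \<Longrightarrow> smooth_density t x \<ge> 0"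
  and smooth_density_le_1: "x \<ge> 0 \<Longrightarrow> smooth_density t x \<le> 1"
  using Psi_le[of x] by (auto simp: smooth_density_def divide_le_eq_1)

lemma smooth_density_mono: "s \<le> t \<Longrightarrow> x \<ge> 1 \<Longrightarrow> smooth_density s x \<le> smooth_density t x"
  unfolding smooth_density_def using Psi_mono[of "x powr s" "x powr t" x]
  by (intro divide_right_mono) (auto intro: powr_mono)

lemma smooth_density_limit_bounds:
  assumes "(smooth_density t \<longlongrightarrow> L) at_top"
  shows "0 \<le> L" "L \<le> 1"
proof -
  have "\<forall>\<^sub>F x in at_top. 0 \<le> smooth_density t x"
    using eventually_ge_at_top[of 0] by eventually_elim (rule smooth_density_nonneg)
  with assms show "0 \<le> L" by (rule tendsto_lowerbound) simp
  have "\<forall>\<^sub>F x in at_top. smooth_density t x \<le> 1"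
    using eventually_ge_at_top[of 0] by eventually_elim (rule smooth_density_le_1)
  with assms show "L \<le> 1" by (rule tendsto_upperbound) simp
qed

lemma smooth_density_limit_mono:
  assumes "(smooth_density s \<longlongrightarrow> K) at_top" "(smooth_density t \<longlongrightarrow> L) at_top" "s \<le> t"
  shows "K \<le> L"
proof (rule tendsto_le[OF _ assms(2,1)])
  show "\<forall>\<^sub>F x in at_top. smooth_density s x \<le> smooth_density t x"
    using eventually_ge_at_top[of 1] by eventually_elim (rule smooth_density_mono[OF assms(3)])
qed simp

text \<open>Part of Buchstab's sum: the density of the integers up to \<open>x\<close> whose largest
  prime factor lies between \<open>x powr a\<close> and \<open>x powr b\<close>.\<close>

definition rough_density :: "real \<Rightarrow> real \<Rightarrow> real \<Rightarrow> real" where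
  "rough_density a b x =
     (\<Sum>p\<in>primes_in (x powr a) (x powr b). real (Psi (x / real p) (real p)) / x)"

lemma rough_density_split:
  assumes "a \<le> b" "b \<le> c" "x \<ge> 1"
  shows "rough_density a c x = rough_density a b x + rough_density b c x"
  unfolding rough_density_def using assms by (intro sum_primes_in_split powr_mono) auto

lemma rough_density_nonneg: "x \<ge> 0 \<Longrightarrow> rough_density a b x \<ge> 0"
  unfolding rough_density_def by (intro sum_nonneg divide_nonneg_nonneg) auto

lemma smooth_density_eq_rough:
  assumes "x \<ge> 1"
  shows "smooth_density t x = of_int \<lfloor>x\<rfloor> / x - rough_density t 1 x"
proof -
  have "real (card (pos_upto x)) = real (Psi x (x powr t)) +
      (\<Sum>p\<in>primes_in (x powr t) (x powr 1). real (Psi (x / real p) (real p)))"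
    using buchstab[of x "x powr t"] assms by simp
  thus ?thesis
    using assms by (simp add: smooth_density_def rough_density_def card_pos_upto field_simps
        flip: sum_divide_distrib)
qed

text \<open>From \<open>p > x powr a\<close> it follows that
  \<open>1 \<le> ln p / (a * ln x)\<close>; inserting this factor turns each term
  \<open>L / p\<close> into a Mertens mass. The lower bound below uses
  \<open>p \<le> x powr b\<close> in the same way.\<close>

lemma rough_density_upper:
  assumes ab: "0 < a" and x: "x > 1" and L: "L \<ge> 0"
    and bound: "\<And>p. p \<in> primes_in (x powr a) (x powr b) \<Longrightarrow>
      real (Psi (x / real p) (real p)) \<le> L * (x / real p)"
  shows "rough_density a b x \<le> L / a * prime_log_density a b x"
proof -
  have "rough_density a b x \<le>
      (\<Sum>p\<in>primes_in (x powr a) (x powr b). L / a * (ln (real p) / real p / ln x))"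
    unfolding rough_density_def
  proof (intro sum_mono)
    fix p assume p: "p \<in> primes_in (x powr a) (x powr b)"
    hence p0: "p > 0" by (auto simp: primes_in_def prime_gt_0_nat)
    have "ln (x powr a) \<le> ln (real p)"
      using p p0 x by (subst ln_le_cancel_iff) (auto simp: primes_in_def)
    hence 1: "1 \<le> ln (real p) / ln x / a"
      using x ab by (simp add: ln_powr field_simps)
    have "real (Psi (x / real p) (real p)) / x \<le> L * (x / real p) / x"
      using bound[OF p] x by (intro divide_right_mono) auto
    also have "\<dots> = L / real p * 1" using x by simp
    also have "\<dots> \<le> L / real p * (ln (real p) / ln x / a)"
      using 1 L by (intro mult_left_mono) auto
    finally show "real (Psi (x / real p) (real p)) / x \<le> L / a * (ln (real p) / real p / ln x)"
      by (simp add: mult_ac)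
  qed
  also have "\<dots> = L / a * prime_log_density a b x"
    by (simp add: prime_log_density_def sum_distrib_left sum_divide_distrib)
  finally show ?thesis .
qed

lemma rough_density_lower:
  assumes ab: "0 < b" and x: "x > 1" and L: "L \<ge> 0"
    and bound: "\<And>p. p \<in> primes_in (x powr a) (x powr b) \<Longrightarrow>
      real (Psi (x / real p) (real p)) \<ge> L * (x / real p)"
  shows "rough_density a b x \<ge> L / b * prime_log_density a b x"
proof -
  have "L / b * prime_log_density a b x =
      (\<Sum>p\<in>primes_in (x powr a) (x powr b). L / b * (ln (real p) / real p / ln x))"
    by (simp add: prime_log_density_def sum_distrib_left sum_divide_distrib)
  also have "\<dots> \<le> rough_density a b x"
    unfolding rough_density_def
  proof (intro sum_mono)
    fix p assume p: "p \<in> primes_in (x powr a) (x powr b)"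
    hence p0: "p > 0" by (auto simp: primes_in_def prime_gt_0_nat)
    have "ln (real p) \<le> ln (x powr b)"
      using p p0 x by (subst ln_le_cancel_iff) (auto simp: primes_in_def)
    hence 1: "1 \<ge> ln (real p) / ln x / b"
      using x ab by (simp add: ln_powr field_simps)
    have "L / b * (ln (real p) / real p / ln x) = L / real p * (ln (real p) / ln x / b)"
      by (simp add: mult_ac)
    also have "\<dots> \<le> L / real p * 1"
      using 1 L by (intro mult_left_mono) auto
    also have "\<dots> = L * (x / real p) / x" using x by simp
    also have "\<dots> \<le> real (Psi (x / real p) (real p)) / x"
      using bound[OF p] x by (intro divide_right_mono) auto
    finally show "L / b * (ln (real p) / real p / ln x) \<le> real (Psi (x / real p) (real p)) / x" .
  qed
  finally show ?thesis .
qed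

text \<open>
  For \<open>p = x\<^sup>s\<close> the number \<open>Psi (x / p) p\<close> has relative smoothness exponent \<open>s / (1 - s)\<close>.
\<close>

lemma Psi_cofactor_bounds:
  assumes ab: "0 < a" "a < b" "b < 1" and x: "x > 1" and p: "p \<in> primes_in (x powr a) (x powr b)"
  defines "X \<equiv> x / real p"
  shows "X \<ge> x powr (1 - b)"
    and "smooth_density (a / (1 - a)) X * X \<le> real (Psi X (real p))"
    and "real (Psi X (real p)) \<le> smooth_density (b / (1 - b)) X * X"
proof -
  have p0: "real p > 0" using p by (auto simp: primes_in_def prime_gt_0_nat)
  have pa: "x powr a < real p" "real p \<le> x powr b" using p by (auto simp: primes_in_def)
  have "x powr (1 - b) = x / x powr b" using x by (simp add: powr_diff)
  also have "\<dots> \<le> X" unfolding X_def using pa p0 x by (intro divide_left_mono) auto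
  finally show X: "X \<ge> x powr (1 - b)" .
  have Xpos: "X > 0" using X x by (auto intro: less_le_trans[of _ "x powr (1-b)"])
  have "X powr (a / (1 - a)) \<le> (x powr (1 - a)) powr (a / (1 - a))"
  proof (intro powr_mono2)
    have "X \<le> x / x powr a" unfolding X_def using pa p0 x by (intro divide_left_mono) auto
    also have "\<dots> = x powr (1 - a)" using x by (simp add: powr_diff)
    finally show "X \<le> x powr (1 - a)" .
  qed (use ab Xpos in auto)
  also have "\<dots> \<le> real p" using ab pa by (simp add: powr_powr)
  finally have "Psi X (X powr (a / (1 - a))) \<le> Psi X (real p)" by (rule Psi_mono)
  thus "smooth_density (a / (1 - a)) X * X \<le> real (Psi X (real p))"
    using Xpos by (simp add: smooth_density_def)
  have "real p \<le> (x powr (1 - b)) powr (b / (1 - b))" using ab pa by (simp add: powr_powr)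
  also have "\<dots> \<le> X powr (b / (1 - b))" using X ab by (intro powr_mono2) auto
  finally have "Psi X (real p) \<le> Psi X (X powr (b / (1 - b)))" by (rule Psi_mono)
  thus "real (Psi X (real p)) \<le> smooth_density (b / (1 - b)) X * X"
    using Xpos by (simp add: smooth_density_def)
qed

text \<open>All cofactors satisfy \<open>x / p \<ge> x powr (1 - b)\<close>, which tends to
  infinity, so one threshold \<open>X0\<close> makes the two limits usable for every prime of the
  block at once. The block has mass close to \<open>b - a\<close>, and its weight lies between
  \<open>1 / b\<close> and \<open>1 / a\<close>.\<close>

lemma rough_density_interval:
  assumes ab: "0 < a" "a < b" "b < 1" and e: "e > 0"
    and La: "(smooth_density (a / (1 - a)) \<longlongrightarrow> La) at_top"
    and Lb: "(smooth_density (b / (1 - b)) \<longlongrightarrow> Lb) at_top"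
  shows "\<forall>\<^sub>F x in at_top. La / b * (b - a) - e \<le> rough_density a b x \<and>
           rough_density a b x \<le> Lb / a * (b - a) + e"
proof -
  \<comment> \<open>Division by \<open>a\<close> and multiplication by \<open>b - a < 1\<close> keep
    this error within \<open>e / 2\<close>; the other half is left for the convergence of the prime
    mass.\<close>
  define e1 where "e1 = e * a / 2"
  have e1: "e1 > 0" using e ab by (simp add: e1_def)
  have "\<forall>\<^sub>F X in at_top. smooth_density (a / (1 - a)) X > La - e1"
    using La e1 by (intro order_tendstoD(1)[OF La]) auto
  moreover have "\<forall>\<^sub>F X in at_top. smooth_density (b / (1 - b)) X < Lb + e1"
    using Lb e1 by (intro order_tendstoD(2)[OF Lb]) auto
  ultimately have "\<forall>\<^sub>F X in at_top. smooth_density (a / (1 - a)) X > La - e1 \<and>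
      smooth_density (b / (1 - b)) X < Lb + e1"
    by (rule eventually_conj)
  then obtain X0 where X0: "\<And>X. X \<ge> X0 \<Longrightarrow> smooth_density (a / (1 - a)) X > La - e1 \<and>
      smooth_density (b / (1 - b)) X < Lb + e1"
    by (auto simp: eventually_at_top_linorder)
  have ev1: "\<forall>\<^sub>F x in at_top. x powr (1 - b) \<ge> X0"
    using eventually_ge_at_top[of "\<bar>X0\<bar> powr (1 / (1 - b))"]
  proof eventually_elim
    case (elim x)
    have "(\<bar>X0\<bar> powr (1 / (1 - b))) powr (1 - b) \<le> x powr (1 - b)"
      using elim ab by (intro powr_mono2) auto
    thus ?case using ab by (simp add: powr_powr)
  qed
  have t: "(prime_log_density a b \<longlongrightarrow> b - a) at_top"
    using ab by (intro prime_log_density_tendsto) auto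
  \<comment> \<open>Truncated at 0 because \<open>rough_density_lower\<close> needs a nonnegative
    factor and \<open>La - e1\<close> may be negative.\<close>
  define La' where "La' = max 0 (La - e1)"
  have ev2: "\<forall>\<^sub>F x in at_top. (Lb + e1) / a * prime_log_density a b x < Lb / a * (b - a) + e"
  proof (rule order_tendstoD(2)[OF tendsto_mult[OF tendsto_const t]])
    have "(Lb + e1) / a * (b - a) = Lb / a * (b - a) + e / 2 * (b - a)"
      using ab by (simp add: e1_def field_simps)
    also have "e / 2 * (b - a) \<le> e / 2 * 1" using ab e by (intro mult_left_mono) auto
    finally show "(Lb + e1) / a * (b - a) < Lb / a * (b - a) + e" using e by simp
  qed
  have ev3: "\<forall>\<^sub>F x in at_top. La' / b * prime_log_density a b x > La / b * (b - a) - e"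
  proof (rule order_tendstoD(1)[OF tendsto_mult[OF tendsto_const t]])
    have "La / b * (b - a) - e < La / b * (b - a) - e / 2 * 1" using e by simp
    also have "\<dots> \<le> La / b * (b - a) - e / 2 * (a / b * (b - a))"
    proof (intro diff_left_mono mult_left_mono)
      have "a / b * (b - a) \<le> 1 * 1" using ab by (intro mult_mono) (auto simp: field_simps)
      thus "a / b * (b - a) \<le> 1" by simp
    qed (use e in auto)
    also have "\<dots> = (La - e1) / b * (b - a)" using ab by (simp add: e1_def field_simps)
    also have "\<dots> \<le> La' / b * (b - a)"
      using ab by (intro mult_right_mono divide_right_mono) (auto simp: La'_def)
    finally show "La / b * (b - a) - e < La' / b * (b - a)" .
  qed
  show ?thesis
    using ev1 ev2 ev3 eventually_gt_at_top[of 1]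
  proof eventually_elim
    case (elim x)
    have "rough_density a b x \<le> (Lb + e1) / a * prime_log_density a b x"
    proof (rule rough_density_upper)
      fix p assume p: "p \<in> primes_in (x powr a) (x powr b)"
      note P = Psi_cofactor_bounds[OF ab elim(4) p]
      have "real (Psi (x / real p) (real p)) \<le> smooth_density (b / (1 - b)) (x / real p) * (x / real p)"
        by (rule P(3))
      also have "\<dots> \<le> (Lb + e1) * (x / real p)"
        using X0[of "x / real p"] P(1) elim by (intro mult_right_mono) auto
      finally show "real (Psi (x / real p) (real p)) \<le> (Lb + e1) * (x / real p)" .
    qed (use ab elim smooth_density_limit_bounds(1)[OF Lb] e1 in auto)
    moreover have "rough_density a b x \<ge> La' / b * prime_log_density a b x"
    proof (rule rough_density_lower)
      fix p assume p: "p \<in> primes_in (x powr a) (x powr b)"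
      note P = Psi_cofactor_bounds[OF ab elim(4) p]
      have "La' * (x / real p) \<le> smooth_density (a / (1 - a)) (x / real p) * (x / real p)"
        using X0[of "x / real p"] P(1) elim smooth_density_nonneg[of "x / real p"]
        by (intro mult_right_mono) (auto simp: La'_def)
      also have "\<dots> \<le> real (Psi (x / real p) (real p))" by (rule P(2))
      finally show "La' * (x / real p) \<le> real (Psi (x / real p) (real p))" .
    qed (use ab elim in \<open>auto simp: La'_def\<close>)
    ultimately show ?case using elim by linarith
  qed
qed

text \<open>
  Riemann sums over a partition of \<open>[t, b]\<close> into \<open>m\<close> equal parts: the upper and lower sums \<open>u\<close>, \<open>l\<close>
  differ by \<open>O(1/m)\<close> because the limits \<open>L i\<close> are increasing and bounded, so their continuity in the
  exponent is not required.
\<close>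

lemma rough_density_converges_interior:
  assumes tb: "0 < t" "t < b" "b < 1"
    and ex: "\<And>s. s \<ge> t / (1 - t) \<Longrightarrow> \<exists>L. (smooth_density s \<longlongrightarrow> L) at_top"
  shows "\<exists>L. (rough_density t b \<longlongrightarrow> L) at_top"
proof (rule convergent_if_approximable)
  fix e :: real assume e: "e > 0"
  \<comment> \<open>This makes \<open>4 * h / t < e\<close>, which covers the gap
    \<open>2 * h / t\<close> between the Riemann sums and the accumulated block errors
    \<open>m * d = h / (2 * t)\<close>.\<close>
  obtain m :: nat where m: "real m > 4 * (b - t) / (t * e)" "m > 0"
    by (metis reals_Archimedean2 gr0I less_trans of_nat_0 of_nat_0_less_iff tb divide_pos_pos diff_gt_0_iff_gt mult_pos_pos e zero_less_numeral)
  define h where "h = (b - t) / real m"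
  have h: "h > 0" "h * real m = b - t" using tb m by (auto simp: h_def)
  have he: "4 * h / t < e"
    using m tb e by (simp add: h_def field_simps)
  define s where "s i = t + real i * h" for i
  have s: "s 0 = t" "s m = b" "\<And>i. s (Suc i) = s i + h" "\<And>i. s i \<ge> t"
    using h by (auto simp: s_def algebra_simps)
  have sb: "s i \<le> b" if "i \<le> m" for i
  proof -
    have "real i * h \<le> real m * h" using that h by (intro mult_right_mono) auto
    thus ?thesis using h by (simp add: s_def algebra_simps)
  qed
  define \<tau> where "\<tau> i = s i / (1 - s i)" for i
  have \<tau>_mono: "\<tau> i \<le> \<tau> j" if "i \<le> j" "j \<le> m" for i j
  proof -
    have "real i * h \<le> real j * h" using that h by (intro mult_right_mono) auto
    hence "s i \<le> s j" by (simp add: s_def)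
    thus ?thesis unfolding \<tau>_def using sb[of j] tb s(4)[of i] that by (intro frac_le) auto
  qed
  have "\<exists>L. (smooth_density (\<tau> i) \<longlongrightarrow> L) at_top" if "i \<le> m" for i
    using \<tau>_mono[of 0 i] that ex[of "\<tau> i"] by (simp add: \<tau>_def s)
  then obtain L where L: "\<And>i. i \<le> m \<Longrightarrow> (smooth_density (\<tau> i) \<longlongrightarrow> L i) at_top"
    by metis
  have L01: "0 \<le> L i" "L i \<le> 1" if "i \<le> m" for i
    using smooth_density_limit_bounds[OF L[OF that]] by auto
  have Lmono: "L i \<le> L (Suc i)" if "Suc i \<le> m" for i
    using that by (intro smooth_density_limit_mono[OF L L \<tau>_mono]) simp_all
  define d where "d = h / (2 * t * real m)"
  have d: "d > 0" using h tb m by (simp add: d_def)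
  \<comment> \<open>The limits increase with \<open>i\<close> while \<open>1 / s i\<close>
    decreases, so each bound takes its two factors from opposite ends of a block.\<close>
  define l where "l n = (\<Sum>i<n. L i / s (Suc i) * h)" for n
  define u where "u n = (\<Sum>i<n. L (Suc i) / s i * h)" for n
  have main: "\<forall>\<^sub>F x in at_top. l n - real n * d \<le> rough_density t (s n) x \<and>
      rough_density t (s n) x \<le> u n + real n * d" if "n \<le> m" for n
    using that
  proof (induction n)
    case 0
    have "rough_density t t x = 0" for x by (simp add: rough_density_def primes_in_def not_le flip: not_less)
    thus ?case by (simp add: l_def u_def s)
  next
    case (Suc n)
    have sn: "0 < s n" "s n < s (Suc n)" "s (Suc n) < 1"
      using s(4)[of n] s(3)[of n] h tb sb[of "Suc n"] Suc.prems by auto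
    have "\<forall>\<^sub>F x in at_top. L n / s (Suc n) * (s (Suc n) - s n) - d \<le> rough_density (s n) (s (Suc n)) x \<and>
           rough_density (s n) (s (Suc n)) x \<le> L (Suc n) / s n * (s (Suc n) - s n) + d"
      using L[of n] L[of "Suc n"] Suc.prems by (intro rough_density_interval[OF sn d]) (auto simp: \<tau>_def)
    moreover have "\<forall>\<^sub>F x in at_top. l n - real n * d \<le> rough_density t (s n) x \<and>
      rough_density t (s n) x \<le> u n + real n * d"
      using Suc by simp
    ultimately show ?case
      using eventually_ge_at_top[of 1]
    proof eventually_elim
      case (elim x)
      have "rough_density t (s (Suc n)) x = rough_density t (s n) x + rough_density (s n) (s (Suc n)) x"
        using elim s(4)[of n] sn by (intro rough_density_split) auto
      thus ?case using elim by (simp add: l_def u_def s(3) algebra_simps)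
    qed
  qed
  \<comment> \<open>Each term of the difference splits into an increment of \<open>L\<close> and an
    increment of \<open>1 / s\<close>; both telescope.\<close>
  have "u n - l n \<le> h * ((L n - L 0) / t + (1 / t - 1 / s n))" if "n \<le> m" for n
    using that
  proof (induction n)
    case (Suc n)
    have pos: "s n > 0" "s (Suc n) > 0" using s(4)[of n] s(4)[of "Suc n"] tb by auto
    have "L (Suc n) / s n - L n / s (Suc n) = (L (Suc n) - L n) / s n + L n * (1 / s n - 1 / s (Suc n))"
      by (simp add: diff_divide_distrib algebra_simps)
    also have "(L (Suc n) - L n) / s n \<le> (L (Suc n) - L n) / t"
      using Lmono[of n] Suc.prems s(4)[of n] tb by (intro divide_left_mono) auto
    also have "L n * (1 / s n - 1 / s (Suc n)) \<le> 1 * (1 / s n - 1 / s (Suc n))"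
      using L01(2)[of n] Suc.prems pos s(3)[of n] h by (intro mult_right_mono) (auto simp: field_simps)
    finally have "h * (L (Suc n) / s n - L n / s (Suc n)) \<le>
        h * ((L (Suc n) - L n) / t + (1 / s n - 1 / s (Suc n)))"
      using h by (intro mult_left_mono) auto
    moreover have "u (Suc n) - l (Suc n) = (u n - l n) + h * (L (Suc n) / s n - L n / s (Suc n))"
      by (simp add: u_def l_def algebra_simps)
    moreover have "u n - l n \<le> h * ((L n - L 0) / t + (1 / t - 1 / s n))" using Suc by simp
    ultimately have "u (Suc n) - l (Suc n) \<le> h * ((L n - L 0) / t + (1 / t - 1 / s n)) +
        h * ((L (Suc n) - L n) / t + (1 / s n - 1 / s (Suc n)))" by linarith
    also have "\<dots> = h * ((L (Suc n) - L 0) / t + (1 / t - 1 / s (Suc n)))"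
      by (simp only: diff_divide_distrib distrib_left [symmetric]) simp
    finally show ?case .
  qed (simp add: u_def l_def s)
  from this[of m] have "u m - l m \<le> h * ((L m - L 0) / t + (1 / t - 1 / b))" by (simp add: s)
  also have "\<dots> \<le> h * (1 / t + 1 / t)"
  proof (intro mult_left_mono add_mono)
    show "(L m - L 0) / t \<le> 1 / t" using L01[of m] L01[of 0] tb by (intro divide_right_mono) auto
  qed (use h tb in auto)
  finally have gap: "u m - l m \<le> 2 * h / t" by (simp add: mult.commute)
  have md: "real m * d = h / (2 * t)" using m by (simp add: d_def)
  have "\<forall>\<^sub>F x in at_top. \<bar>rough_density t b x - l m\<bar> \<le> e"
    using main[of m, OF order_refl] unfolding s(2)
  proof eventually_elim
    case (elim x)
    have "h / (2 * t) \<le> h / t" "h / t > 0" using h tb by (auto intro!: divide_left_mono)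
    moreover have "4 * h / t = 4 * (h / t)" "2 * h / t = 2 * (h / t)" by simp_all
    ultimately show ?case using elim gap he md by linarith
  qed
  thus "\<exists>l. \<forall>\<^sub>F x in at_top. \<bar>rough_density t b x - l\<bar> \<le> e" by blast
qed simp

text \<open>The relative exponent \<open>b / (1 - b)\<close> blows up at 1, so the range above
  \<open>b\<close> is cut off. There the trivial bound \<open>Psi_le\<close> suffices, since the
  prime mass of that range is small.\<close>

lemma rough_density_converges:
  assumes t: "0 < t" "t < 1"
    and ex: "\<And>s. s \<ge> t / (1 - t) \<Longrightarrow> \<exists>L. (smooth_density s \<longlongrightarrow> L) at_top"
  shows "\<exists>L. (rough_density t 1 \<longlongrightarrow> L) at_top"
proof (rule convergent_if_approximable)
  fix e :: real assume e: "e > 0"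
  \<comment> \<open>The first entry gives \<open>t < b\<close>; the second bounds the limiting tail
    \<open>(1 - b) / b\<close> by \<open>e / 4\<close>, because
    \<open>1 / b \<le> 1 / t\<close>.\<close>
  define b where "b = max ((1 + t) / 2) (1 - t * e / 4)"
  have b: "t < b" "b < 1" "1 - b \<le> t * e / 4"
  proof -
    have "t * e > 0" using t e by simp
    thus "b < 1" using t by (simp add: b_def)
    have "(1 + t) / 2 \<le> b" "1 - t * e / 4 \<le> b" by (simp_all add: b_def)
    thus "t < b" and "1 - b \<le> t * e / 4" using t by auto
  qed
  obtain L where L: "(rough_density t b \<longlongrightarrow> L) at_top"
    using rough_density_converges_interior[OF t(1) b(1,2) ex] by blast
  have "\<forall>\<^sub>F x in at_top. \<bar>rough_density t b x - L\<bar> < e / 2"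
    using tendstoD[OF L, of "e/2"] e by (simp add: dist_real_def)
  moreover have "\<forall>\<^sub>F x in at_top. 1 / b * prime_log_density b 1 x < e / 2"
  proof (rule order_tendstoD(2)[OF tendsto_mult[OF tendsto_const prime_log_density_tendsto]])
    have "1 / b * (1 - b) \<le> 1 / t * (t * e / 4)"
      using b t by (intro mult_mono) (auto simp: field_simps)
    also have "\<dots> < e / 2" using t e by simp
    finally show "1 / b * (1 - b) < e / 2" .
  qed (use b t in auto)
  ultimately have "\<forall>\<^sub>F x in at_top. \<bar>rough_density t 1 x - L\<bar> \<le> e"
    using eventually_gt_at_top[of 1]
  proof eventually_elim
    case (elim x)
    have "rough_density b 1 x \<le> 1 / b * prime_log_density b 1 x"
      using b t elim by (intro rough_density_upper) (auto intro!: Psi_le)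
    moreover have "rough_density b 1 x \<ge> 0" using elim by (intro rough_density_nonneg) auto
    moreover have "rough_density t 1 x = rough_density t b x + rough_density b 1 x"
      using b elim by (intro rough_density_split) auto
    ultimately show ?case using elim by linarith
  qed
  thus "\<exists>l. \<forall>\<^sub>F x in at_top. \<bar>rough_density t 1 x - l\<bar> \<le> e" by blast
qed simp

lemma floor_over_self_tendsto: "((\<lambda>x::real. of_int \<lfloor>x\<rfloor> / x) \<longlongrightarrow> 1) at_top"
proof (rule tendsto_sandwich)
  show "\<forall>\<^sub>F x::real in at_top. 1 - inverse x \<le> of_int \<lfloor>x\<rfloor> / x"
    using eventually_gt_at_top[of 0]
  proof eventually_elim
    case (elim x)
    have "(x - 1) / x \<le> of_int \<lfloor>x\<rfloor> / x"
      using elim floor_correct[of x] by (intro divide_right_mono) linarith+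
    thus ?case using elim by (simp add: field_simps)
  qed
  show "\<forall>\<^sub>F x::real in at_top. of_int \<lfloor>x\<rfloor> / x \<le> 1"
    using eventually_gt_at_top[of 0] by eventually_elim simp
  have "((\<lambda>x::real. 1 - inverse x) \<longlongrightarrow> 1 - 0) at_top"
    by (intro tendsto_diff tendsto_const tendsto_inverse_0_at_top filterlim_ident)
  thus "((\<lambda>x::real. 1 - inverse x) \<longlongrightarrow> 1) at_top" by simp
qed simp

text \<open>For \<open>t \<ge> 1\<close> every integer up to \<open>x\<close> is smooth and the
  density is that of all integers. The induction must cover all larger exponents at each stage,
  since Buchstab's sum involves every relative exponent from \<open>t / (1 - t)\<close>
  upwards.\<close>

lemma smooth_density_converges_inverse:
  "t \<ge> 1 / real (Suc k) \<Longrightarrow> \<exists>L. (smooth_density t \<longlongrightarrow> L) at_top"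
proof (induction k arbitrary: t)
  case 0
  have "\<forall>\<^sub>F x in at_top. of_int \<lfloor>x\<rfloor> / x = smooth_density t x"
    using eventually_gt_at_top[of 1]
  proof eventually_elim
    case (elim x)
    have "x powr 1 \<le> x powr t" using elim 0 by (intro powr_mono) auto
    hence "rough_density t 1 x = 0" using elim by (auto simp: rough_density_def primes_in_def intro!: sum.neutral)
    thus ?case using elim smooth_density_eq_rough[of x t] by simp
  qed
  thus ?case using floor_over_self_tendsto by (blast intro: Lim_transform_eventually)
next
  case (Suc k)
  show ?case
  proof (cases "t \<ge> 1 / real (Suc k)")
    case True
    thus ?thesis by (rule Suc.IH)
  next
    case False
    have t: "0 < t" "t < 1"
    proof -
      have "0 < 1 / real (Suc (Suc k))" by simp
      thus "0 < t" using Suc.prems by linarith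
      have "1 / real (Suc k) \<le> 1" by simp
      thus "t < 1" using False by linarith
    qed
    have "1 / real (Suc k) \<le> t / (1 - t)" using t Suc.prems by (simp add: field_simps)
    hence "\<exists>L. (rough_density t 1 \<longlongrightarrow> L) at_top"
      by (intro rough_density_converges t Suc.IH) linarith
    then obtain L where L: "(rough_density t 1 \<longlongrightarrow> L) at_top" ..
    have "((\<lambda>x. of_int \<lfloor>x\<rfloor> / x - rough_density t 1 x) \<longlongrightarrow> 1 - L) at_top"
      by (intro tendsto_diff floor_over_self_tendsto L)
    moreover have "\<forall>\<^sub>F x in at_top. of_int \<lfloor>x\<rfloor> / x - rough_density t 1 x = smooth_density t x"
      using eventually_ge_at_top[of 1] by eventually_elim (simp add: smooth_density_eq_rough)
    ultimately show ?thesis by (blast intro: Lim_transform_eventually)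
  qed
qed

text \<open>Proved convergence is what turns the \<open>Lim\<close> in \<open>dickman_rho\<close>
  into an actual limit.\<close>

lemma smooth_density_tendsto_dickman_rho:
  assumes "t > 0"
  shows "(smooth_density t \<longlongrightarrow> dickman_rho (1 / t)) at_top"
proof -
  obtain k where "1 / t < real k" using reals_Archimedean2 by blast
  hence "1 / t \<le> real (Suc k)" by simp
  hence "t \<ge> 1 / real (Suc k)" using assms by (simp add: field_simps)
  then obtain L where L: "(smooth_density t \<longlongrightarrow> L) at_top"
    using smooth_density_converges_inverse by blast
  have "dickman_rho (1 / t) = Lim at_top (smooth_density t)"
    by (simp add: dickman_rho_def smooth_density_def [abs_def])
  also have "\<dots> = L" using L by (intro tendsto_Lim) auto
  finally show ?thesis using L by simp
qed

subsection \<open>Weights on Local-Global sets\<close>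

text \<open>
  The cofactor \<open>s / q \<le> x / q\<close> lies below the least prime factor of \<open>q\<close>.
\<close>

lemma smooth_multiple_of_LG_N:
  assumes "q \<in> LG_N d x" "s \<in> pos_upto x" "q dvd s" "smooth y q"
  shows "smooth y s"
proof -
  obtain ps where ps: "ps \<noteq> []" "q = prod_list ps" "\<forall>p\<in>set ps. prime p"
      "x / real (prod_list ps) < real (last ps)"
    using assms(1) by (auto simp: LG_N_def)
  obtain m where m: "s = q * m" using assms(3) by (elim dvdE)
  have s0: "s > 0" "real s \<le> x" using assms(2) by (auto simp: pos_upto_def)
  hence q0: "q > 0" "m > 0" using m by auto
  have "last ps dvd q"
    using ps(1,2) by (metis append_butlast_last_id dvd_triv_right mult.right_neutral prod_list.Cons
        prod_list.Nil prod_list.append)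
  moreover have "prime (last ps)" using ps(1,3) by simp
  ultimately have last: "real (last ps) \<le> y" using assms(4) by (auto simp: smooth_def)
  show ?thesis
    unfolding smooth_def
  proof (intro allI impI)
    fix p assume p: "prime p \<and> p dvd s"
    hence "p dvd q \<or> p dvd m" using m prime_dvd_multD by blast
    thus "real p \<le> y"
    proof
      assume "p dvd q"
      thus ?thesis using assms(4) p by (auto simp: smooth_def)
    next
      assume "p dvd m"
      hence "p \<le> m" using q0 by (auto dest: dvd_imp_le)
      hence "real p \<le> real m" by simp
      also have "real m \<le> x / real q" using s0 q0 m by (simp add: field_simps)
      also have "\<dots> < real (last ps)" using ps by simp
      finally show ?thesis using last by linarith
    qed
  qed
qed

lemma smooth_dvd: "smooth y s \<Longrightarrow> q dvd s \<Longrightarrow> smooth y q"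
  by (auto simp: smooth_def intro: dvd_trans)

section \<open>Counting multiples of members of an LG set\<close>

lemma card_multiples_upto:
  assumes "x \<ge> 0" "q > 0"
  shows "real (card {s \<in> pos_upto x. q dvd s}) \<le> x / real q"
    and "real (card {s \<in> pos_upto x. q dvd s}) \<ge> x / real q - 1"
proof -
  have "{s \<in> pos_upto x. q dvd s} = (\<lambda>m. q * m) ` pos_upto (x / real q)"
    using assms by (auto simp: pos_upto_def field_simps Suc_le_eq intro!: image_eqI elim!: dvdE)
  hence "card {s \<in> pos_upto x. q dvd s} = card (pos_upto (x / real q))"
    using assms by (simp add: card_image inj_on_def)
  hence "real (card {s \<in> pos_upto x. q dvd s}) = of_int \<lfloor>x / real q\<rfloor>"
    using assms by (simp add: card_pos_upto)
  thus "real (card {s \<in> pos_upto x. q dvd s}) \<le> x / real q"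
    and "real (card {s \<in> pos_upto x. q dvd s}) \<ge> x / real q - 1"
    by (simp, linarith)
qed

text \<open>A common multiple \<open>s \<le> x\<close> of two members would be at least their lcm,
  so the sets of multiples are disjoint.\<close>

lemma sum_over_multiples:
  fixes w :: "nat \<Rightarrow> real"
  assumes fin: "finite M" and lcm: "\<And>m n. m \<in> M \<Longrightarrow> n \<in> M \<Longrightarrow> m \<noteq> n \<Longrightarrow> real (lcm m n) > x"
  shows "(\<Sum>q\<in>M. \<Sum>s\<in>{s \<in> pos_upto x. q dvd s}. w s) =
      (\<Sum>s\<in>{s \<in> pos_upto x. \<exists>q\<in>M. q dvd s}. w s)"
proof -
  have "{s \<in> pos_upto x. \<exists>q\<in>M. q dvd s} = (\<Union>q\<in>M. {s \<in> pos_upto x. q dvd s})" by auto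
  moreover have "{s \<in> pos_upto x. m dvd s} \<inter> {s \<in> pos_upto x. n dvd s} = {}"
    if "m \<in> M" "n \<in> M" "m \<noteq> n" for m n
  proof -
    have False if "s \<in> pos_upto x" "m dvd s" "n dvd s" for s
    proof -
      have "lcm m n \<le> s" using that by (intro dvd_imp_le lcm_least) (auto simp: pos_upto_def)
      hence "real (lcm m n) \<le> x" using that(1) by (auto simp: pos_upto_def)
      thus False using lcm[OF \<open>m \<in> M\<close> \<open>n \<in> M\<close> \<open>m \<noteq> n\<close>] by simp
    qed
    thus ?thesis by blast
  qed
  ultimately show ?thesis using fin by (simp add: sum.UNION_disjoint)
qed

text \<open>Unit weights turn the disjoint union into a count. Rounding \<open>x / q\<close> down
  costs nothing in the first bound and at most 1 per member in the second.\<close>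

lemma sum_inverse_bounds:
  assumes fin: "finite M" and lcm: "\<And>m n. m \<in> M \<Longrightarrow> n \<in> M \<Longrightarrow> m \<noteq> n \<Longrightarrow> real (lcm m n) > x"
    and x: "x \<ge> 0" and pos: "\<And>q. q \<in> M \<Longrightarrow> q > 0"
  shows "real (card {s \<in> pos_upto x. \<exists>q\<in>M. q dvd s}) \<le> x * (\<Sum>q\<in>M. 1 / real q)"
    and "x * (\<Sum>q\<in>M. 1 / real q) - real (card M) \<le> real (card {s \<in> pos_upto x. \<exists>q\<in>M. q dvd s})"
proof -
  have eq: "real (card {s \<in> pos_upto x. \<exists>q\<in>M. q dvd s}) = (\<Sum>q\<in>M. real (card {s \<in> pos_upto x. q dvd s}))"
    using sum_over_multiples[OF fin lcm, where w = "\<lambda>_. 1"] by simp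
  show "real (card {s \<in> pos_upto x. \<exists>q\<in>M. q dvd s}) \<le> x * (\<Sum>q\<in>M. 1 / real q)"
    unfolding eq sum_distrib_left
    by (intro sum_mono) (use card_multiples_upto(1)[OF x] pos in simp)
  have "x * (\<Sum>q\<in>M. 1 / real q) - real (card M) = (\<Sum>q\<in>M. x / real q - 1)"
    by (simp add: sum_subtractf sum_distrib_left)
  also have "\<dots> \<le> (\<Sum>q\<in>M. real (card {s \<in> pos_upto x. q dvd s}))"
    by (intro sum_mono) (use card_multiples_upto(2)[OF x] pos in simp)
  finally show "x * (\<Sum>q\<in>M. 1 / real q) - real (card M) \<le> real (card {s \<in> pos_upto x. \<exists>q\<in>M. q dvd s})"
    unfolding eq .
qed

text \<open>An element of \<open>A\<close> is exceptional, a multiple of an integer equal to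
  \<open>x powr c\<close>, or a multiple of a member of \<open>M\<close>; the three summands on the
  right count these cases. It serves both for all integers and for the smooth ones alone.\<close>

lemma LG_set_coverage:
  assumes LG: "LG_set N \<epsilon> c x" and x: "x > 1"
    and A: "A \<subseteq> pos_upto x" 
    and M: "\<And>q s. q \<in> N \<Longrightarrow> real q < x powr c \<Longrightarrow> s \<in> A \<Longrightarrow> q dvd s \<Longrightarrow> q \<in> M"
    and MN: "M \<subseteq> N"
  shows "real (card A) / x \<le> (\<Sum>q\<in>M. 1 / real q) + \<epsilon> + x powr (-c)"
proof -
  have N: "\<And>q. q \<in> N \<Longrightarrow> 2 \<le> q \<and> real q \<le> x"
    and lcm: "\<And>m n. m \<in> N \<Longrightarrow> n \<in> N \<Longrightarrow> m \<noteq> n \<Longrightarrow> real (lcm m n) > x"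
    and few: "real (card {m \<in> pos_upto x. \<not> (\<exists>n\<in>N. real n \<le> x powr c \<and> n dvd m)}) \<le> \<epsilon> * x"
    using LG by (auto simp: LG_set_def)
  have "finite N"
    using N by (intro finite_subset[OF _ finite_pos_upto[of x]]) (force simp: pos_upto_def)
  hence finM: "finite M" using MN finite_subset by blast
  \<comment> \<open>\<open>LG_set\<close> allows \<open>n = x powr c\<close>, which the strict bound on \<open>q\<close> excludes.\<close>
  define E where "E = {q. real q = x powr c \<and> q > 0}"
  define D where "D = {s \<in> pos_upto x. \<exists>q\<in>E. q dvd s}"
  \<comment> \<open>\<open>E\<close> contains at most the integer \<open>x powr c\<close>, which has
    at most \<open>x / x powr c\<close> multiples.\<close>
  have D: "real (card D) \<le> x * x powr (-c)"
  proof (cases "E = {}")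
    case False
    then obtain q where q: "real q = x powr c" "q > 0" by (auto simp: E_def)
    hence "E = {q}" by (auto simp: E_def simp flip: of_nat_eq_iff[where 'a = real])
    hence "real (card D) \<le> x / real q"
      using card_multiples_upto(1)[of x q] x q by (simp add: D_def)
    thus ?thesis using q x by (simp add: powr_minus_divide)
  qed (use x in \<open>simp add: D_def\<close>)
  have "A \<subseteq> {m \<in> pos_upto x. \<not> (\<exists>n\<in>N. real n \<le> x powr c \<and> n dvd m)} \<union> D \<union>
      {s \<in> pos_upto x. \<exists>q\<in>M. q dvd s}" (is "_ \<subseteq> ?U \<union> D \<union> ?V")
  proof
    fix s assume s: "s \<in> A"
    show "s \<in> ?U \<union> D \<union> ?V"
    proof (cases "s \<in> ?U")
      case False
      then obtain n where n: "n \<in> N" "real n \<le> x powr c" "n dvd s" using s A by auto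
      show ?thesis
      proof (cases "real n = x powr c")
        case True
        thus ?thesis using n N[of n] s A by (auto simp: D_def E_def)
      next
        case False
        hence "n \<in> M" using M[of n s] n s by simp
        thus ?thesis using n s A by auto
      qed
    qed auto
  qed
  hence "card A \<le> card (?U \<union> D \<union> ?V)" by (intro card_mono) (auto simp: D_def)
  also have "\<dots> \<le> card ?U + card D + card ?V"
    using card_Un_le[of "?U \<union> D" ?V] card_Un_le[of ?U D] by linarith
  finally have "real (card A) \<le> real (card ?U) + real (card D) + real (card ?V)" by linarith
  also have "\<dots> \<le> \<epsilon> * x + x * x powr (-c) + x * (\<Sum>q\<in>M. 1 / real q)"
    using few D finM MN N lcm x
    by (intro add_mono sum_inverse_bounds(1)) (auto simp: subset_iff dest!: N)
  finally show ?thesis using x by (simp add: field_simps)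
qed

text \<open>The theorem at one fixed \<open>x\<close>, with all asymptotics turned into numerical
  hypotheses. (A) bounds the smooth weight from below; (B) bounds the non-smooth weight from below
  and hence, within the total \<open>\<sigma>\<close>, the smooth weight from above.\<close>

lemma weighted_smooth_sum_bounds:
  fixes w :: "nat \<Rightarrow> real"
  assumes LG: "LG_set (LG_N d x) \<epsilon> c x" and x: "x > 1"
    and w: "\<And>s. s \<in> pos_upto x \<Longrightarrow> w s \<ge> 0"
    and eps: "\<epsilon> \<le> \<gamma> / 4" and gamma: "\<gamma> > 0"
    and small: "x powr (-c) \<le> \<epsilon> / 2" "x powr (c - 1) < 1 / 2" "\<bar>of_int \<lfloor>x\<rfloor> / x - 1\<bar> < \<gamma> / 8"
    and rho: "smooth_density \<theta> x > r - \<epsilon> / 2" and eps0: "\<epsilon> > 0"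
  defines "N1 \<equiv> {q \<in> LG_N d x. smooth (x powr \<theta>) q \<and> real q < x powr c}"
  defines "N2 \<equiv> {q \<in> LG_N d x. \<not> smooth (x powr \<theta>) q \<and> real q < x powr c}"
  defines "\<sigma> \<equiv> (\<Sum>s\<in>pos_upto x. w s)"
  defines "S \<equiv> (\<Sum>s\<in>{s \<in> pos_upto x. smooth (x powr \<theta>) s}. w s)"
  assumes A: "(\<Sum>q\<in>N1. \<Sum>s\<in>{s \<in> pos_upto x. q dvd s}. w s) > (1 - \<gamma>) * \<sigma> * (\<Sum>q\<in>N1. 1 / real q)"
  shows "S > (1 - \<gamma>) * \<sigma> * (\<Sum>q\<in>N1. 1 / real q)" 
    and "\<gamma> < 1 \<Longrightarrow> (1 - \<gamma>) * \<sigma> * (\<Sum>q\<in>N1. 1 / real q) > (1 - \<gamma>) * (r - 2 * \<epsilon>) * \<sigma>"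
    and "(\<Sum>q\<in>N2. \<Sum>s\<in>{s \<in> pos_upto x. q dvd s}. w s) > (1 - \<gamma>) * \<sigma> * (\<Sum>q\<in>N2. 1 / real q) \<Longrightarrow>
      \<bar>S - \<sigma> * (\<Sum>q\<in>N1. 1 / real q)\<bar> < 2 * \<gamma> * \<sigma>"
proof -
  let ?N = "LG_N d x"
  define M1 where "M1 = (\<Sum>q\<in>N1. 1 / real q)"
  define M2 where "M2 = (\<Sum>q\<in>N2. 1 / real q)"
  have N: "\<And>q. q \<in> ?N \<Longrightarrow> 2 \<le> q \<and> real q \<le> x"
    and lcm: "\<And>m n. m \<in> ?N \<Longrightarrow> n \<in> ?N \<Longrightarrow> m \<noteq> n \<Longrightarrow> real (lcm m n) > x"
    using LG by (auto simp: LG_set_def)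
  have finN: "finite ?N"
    using N by (intro finite_subset[OF _ finite_pos_upto[of x]]) (force simp: pos_upto_def)
  have sub: "N1 \<subseteq> ?N" "N2 \<subseteq> ?N" "N1 \<inter> N2 = {}" by (auto simp: N1_def N2_def)
  have fin: "finite N1" "finite N2" using sub finN finite_subset by blast+
  have nonneg: "M1 \<ge> 0" "M2 \<ge> 0" by (auto simp: M1_def M2_def intro!: sum_nonneg)
  define S1 where "S1 = {s \<in> pos_upto x. \<exists>q\<in>N1. q dvd s}"
  define S2 where "S2 = {s \<in> pos_upto x. \<exists>q\<in>N2. q dvd s}"
  have A': "sum w S1 > (1 - \<gamma>) * \<sigma> * M1"
    using A sum_over_multiples[OF fin(1), of x w] lcm sub by (auto simp: S1_def M1_def subset_iff)
  have S1: "S1 \<subseteq> {s \<in> pos_upto x. smooth (x powr \<theta>) s}"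
    by (auto simp: S1_def N1_def intro: smooth_multiple_of_LG_N)
  have S2: "S2 \<subseteq> {s \<in> pos_upto x. \<not> smooth (x powr \<theta>) s}"
    by (auto simp: S2_def N2_def dest: smooth_dvd)
  \<comment> \<open>With total weight 0 both sides of (A) vanish, against its strictness. Positivity
    of \<open>\<sigma>\<close> makes the conclusions strict.\<close>
  have "\<sigma> \<noteq> 0"
  proof
    assume "\<sigma> = 0"
    hence "\<forall>s\<in>pos_upto x. w s = 0" using w by (simp add: \<sigma>_def sum_nonneg_eq_0_iff)
    hence "sum w S1 = 0" by (intro sum.neutral) (auto simp: S1_def)
    thus False using A' \<open>\<sigma> = 0\<close> by simp
  qed
  moreover have "\<sigma> \<ge> 0" unfolding \<sigma>_def by (intro sum_nonneg w)
  ultimately have \<sigma>: "\<sigma> > 0" by simp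
  have "sum w S1 \<le> S" unfolding S_def using S1 w by (intro sum_mono2) auto
  with A' have lower: "S > (1 - \<gamma>) * \<sigma> * M1" by linarith
  thus "S > (1 - \<gamma>) * \<sigma> * (\<Sum>q\<in>N1. 1 / real q)" by (simp add: M1_def)

  \<comment> \<open>The loss \<open>2 * \<epsilon>\<close> consists of \<open>\<epsilon>\<close> for
    the exceptions, \<open>\<epsilon> / 2\<close> for \<open>x powr (-c)\<close> and
    \<open>\<epsilon> / 2\<close> for the distance from \<open>r\<close>.\<close>
  have "real (Psi x (x powr \<theta>)) / x \<le> M1 + \<epsilon> + x powr (-c)"
    unfolding Psi_def M1_def using sub(1)
    by (intro LG_set_coverage[OF LG x]) (auto simp: N1_def dest: smooth_dvd)
  hence "M1 > r - 2 * \<epsilon>"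
    using rho small(1) eps0 unfolding smooth_density_def by linarith
  thus "(1 - \<gamma>) * \<sigma> * (\<Sum>q\<in>N1. 1 / real q) > (1 - \<gamma>) * (r - 2 * \<epsilon>) * \<sigma>" if "\<gamma> < 1"
    using that \<sigma> by (simp add: M1_def)

  have cover: "of_int \<lfloor>x\<rfloor> / x \<le> M1 + M2 + \<epsilon> + x powr (-c)"
  proof -
    have "real (card (pos_upto x)) / x \<le> (\<Sum>q\<in>N1 \<union> N2. 1 / real q) + \<epsilon> + x powr (-c)"
      using sub by (intro LG_set_coverage[OF LG x]) (auto simp: N1_def N2_def)
    also have "(\<Sum>q\<in>N1 \<union> N2. 1 / real q) = M1 + M2"
      unfolding M1_def M2_def using fin sub by (intro sum.union_disjoint) auto
    finally show ?thesis using x by (simp add: card_pos_upto)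
  qed
  \<comment> \<open>The disjoint sets of multiples fit into \<open>x\<close> integers, and rounding
    loses at most the number of members, which is at most \<open>x powr c < x / 2\<close>.\<close>
  have pack: "M1 + M2 < 3 / 2"
  proof -
    have "x * (\<Sum>q\<in>N1 \<union> N2. 1 / real q) - real (card (N1 \<union> N2)) \<le>
        real (card {s \<in> pos_upto x. \<exists>q\<in>N1 \<union> N2. q dvd s})"
      using fin sub lcm N x by (intro sum_inverse_bounds(2)) (auto simp: subset_iff dest!: N)
    also have "\<dots> \<le> real (card (pos_upto x))" by (intro of_nat_mono card_mono) auto
    also have "\<dots> \<le> x" using x by (simp add: card_pos_upto)
    finally have 1: "x * (M1 + M2) - real (card (N1 \<union> N2)) \<le> x"
      using fin sub by (simp add: M1_def M2_def sum.union_disjoint)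
    have "N1 \<union> N2 \<subseteq> pos_upto (x powr c)" using N by (force simp: N1_def N2_def pos_upto_def)
    hence "card (N1 \<union> N2) \<le> card (pos_upto (x powr c))" by (intro card_mono) auto
    hence "real (card (N1 \<union> N2)) \<le> x powr c" using card_pos_upto[of "x powr c"] by simp linarith
    also have "x powr c = x * x powr (c - 1)" using x by (simp add: powr_diff)
    also have "\<dots> < x * (1 / 2)" using small(2) x by (intro mult_strict_left_mono) auto
    finally have "x * (M1 + M2) < x * (3 / 2)" using 1 by linarith
    thus ?thesis using x by simp
  qed

  show "\<bar>S - \<sigma> * (\<Sum>q\<in>N1. 1 / real q)\<bar> < 2 * \<gamma> * \<sigma>"
    if B: "(\<Sum>q\<in>N2. \<Sum>s\<in>{s \<in> pos_upto x. q dvd s}. w s) > (1 - \<gamma>) * \<sigma> * (\<Sum>q\<in>N2. 1 / real q)"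
  proof -
    have B': "sum w S2 > (1 - \<gamma>) * \<sigma> * M2"
      using B sum_over_multiples[OF fin(2), of x w] lcm sub by (auto simp: S2_def M2_def subset_iff)
    have "S + sum w S2 = sum w ({s \<in> pos_upto x. smooth (x powr \<theta>) s} \<union> S2)"
      unfolding S_def using S2 by (subst sum.union_disjoint) (auto simp: S2_def)
    also have "\<dots> \<le> \<sigma>" unfolding \<sigma>_def using w by (intro sum_mono2) (auto simp: S2_def)
    finally have "S - \<sigma> * M1 < \<sigma> - (1 - \<gamma>) * \<sigma> * M2 - \<sigma> * M1" using B' by linarith
    also have "\<dots> = \<sigma> * (1 - (M1 + M2) + \<gamma> * M2)" by (simp add: algebra_simps)
    \<comment> \<open>The failure of the reciprocals to reach 1 costs \<open>\<gamma> / 2\<close>: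
      floor, exceptions and \<open>x powr (-c)\<close>. With \<open>M2 \<le> 3 / 2\<close> the total
      is exactly \<open>2 * \<gamma>\<close>.\<close>
    also have "\<dots> \<le> \<sigma> * (\<gamma> / 8 + \<gamma> / 4 + \<gamma> / 8 + \<gamma> * (3 / 2))"
    proof (intro mult_left_mono add_mono)
      show "1 - (M1 + M2) \<le> \<gamma> / 8 + \<gamma> / 4 + \<gamma> / 8" using cover small eps by linarith
      show "M2 \<le> 3 / 2" using pack nonneg by linarith
    qed (use \<sigma> gamma in auto)
    also have "\<dots> = 2 * \<gamma> * \<sigma>" by simp
    finally have upper: "S - \<sigma> * M1 < 2 * \<gamma> * \<sigma>" .
    have "\<gamma> * \<sigma> * M1 \<le> \<gamma> * \<sigma> * (3 / 2)" using pack nonneg gamma \<sigma> by (intro mult_left_mono) auto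
    moreover have "\<gamma> * \<sigma> > 0" using gamma \<sigma> by simp
    ultimately have "S - \<sigma> * M1 > - (2 * \<gamma> * \<sigma>)" using lower by (simp add: algebra_simps)
    thus ?thesis using upper by (simp add: M1_def abs_less_iff)
  qed
qed

text \<open>The threshold for \<open>x\<close> precedes \<open>w\<close>, so it is uniform in the
  weights. The last inequality is restricted to \<open>\<gamma> < 1\<close>: at
  \<open>\<gamma> = 1\<close> both its sides are 0, and beyond that the negative factor
  \<open>1 - \<gamma>\<close> reverses it.\<close>

theorem theorem2:
  fixes \<epsilon>0 :: real and \<delta> c :: "real \<Rightarrow> real" and \<theta> \<gamma> :: real
  assumes eps0: "\<epsilon>0 > 0"
    and LG: "\<And>\<epsilon>. 0 < \<epsilon> \<Longrightarrow> \<epsilon> < \<epsilon>0 \<Longrightarrow>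
          0 < \<delta> \<epsilon> \<and> \<delta> \<epsilon> < 1 \<and> 0 < c \<epsilon> \<and> c \<epsilon> < 1 \<and>
          (\<forall>\<^sub>F x in at_top. LG_set (LG_N (\<delta> \<epsilon>) x) \<epsilon> (c \<epsilon>) x)"
    and theta: "0 < \<theta>" "\<theta> \<le> 1"
    and gamma: "\<gamma> > 0"
  shows "\<exists>\<epsilon>. 0 < \<epsilon> \<and> \<epsilon> < 1 \<and> \<epsilon> < \<epsilon>0 \<and>
    (\<forall>\<^sub>F x in at_top. \<forall>w :: nat \<Rightarrow> real. (\<forall>s\<in>pos_upto x. w s \<ge> 0) \<longrightarrow>
      (let N = LG_N (\<delta> \<epsilon>) x;
           N1 = {q \<in> N. smooth (x powr \<theta>) q \<and> real q < x powr (c \<epsilon>)};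
           N2 = {q \<in> N. \<not> smooth (x powr \<theta>) q \<and> real q < x powr (c \<epsilon>)};
           \<sigma> = (\<Sum>s\<in>pos_upto x. w s);
           S = (\<Sum>s\<in>{s \<in> pos_upto x. smooth (x powr \<theta>) s}. w s);
           A = ((\<Sum>q\<in>N1. \<Sum>s\<in>{s \<in> pos_upto x. q dvd s}. w s)
                  > (1 - \<gamma>) * \<sigma> * (\<Sum>q\<in>N1. 1 / real q));
           B = ((\<Sum>q\<in>N2. \<Sum>s\<in>{s \<in> pos_upto x. q dvd s}. w s)
                  > (1 - \<gamma>) * \<sigma> * (\<Sum>q\<in>N2. 1 / real q))
       in (A \<and> B \<longrightarrow> \<bar>S - \<sigma> * (\<Sum>q\<in>N1. 1 / real q)\<bar> < 2 * \<gamma> * \<sigma>) \<and>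
          (A \<longrightarrow> S > (1 - \<gamma>) * \<sigma> * (\<Sum>q\<in>N1. 1 / real q) \<and>
             (\<gamma> < 1 \<longrightarrow> (1 - \<gamma>) * \<sigma> * (\<Sum>q\<in>N1. 1 / real q)
                           > (1 - \<gamma>) * (dickman_rho (1 / \<theta>) - 2 * \<epsilon>) * \<sigma>))))"
proof -
  \<comment> \<open>The first two entries keep \<open>\<epsilon>\<close> in the required range;
    \<open>\<gamma> / 4\<close> is its share of the error in the upper bound.\<close>
  define \<epsilon> where "\<epsilon> = min (\<epsilon>0 / 2) (min (1 / 2) (\<gamma> / 4))"
  have e: "0 < \<epsilon>" "\<epsilon> < 1" "\<epsilon> < \<epsilon>0" "\<epsilon> \<le> \<gamma> / 4" using eps0 gamma by (auto simp: \<epsilon>_def)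
  from LG[OF e(1,3)] have c: "0 < c \<epsilon>" "c \<epsilon> < 1"
    and evLG: "\<forall>\<^sub>F x in at_top. LG_set (LG_N (\<delta> \<epsilon>) x) \<epsilon> (c \<epsilon>) x" by auto
  have powr0: "((\<lambda>x::real. x powr s) \<longlongrightarrow> 0) at_top" if "s < 0" for s
    using that by (intro tendsto_neg_powr filterlim_ident) auto
  have ev1: "\<forall>\<^sub>F x::real in at_top. x powr (- c \<epsilon>) < \<epsilon> / 2"
    using e c by (intro order_tendstoD(2)[OF powr0]) auto
  have ev2: "\<forall>\<^sub>F x::real in at_top. x powr (c \<epsilon> - 1) < 1 / 2"
    using c by (intro order_tendstoD(2)[OF powr0]) auto
  have ev3: "\<forall>\<^sub>F x::real in at_top. \<bar>of_int \<lfloor>x\<rfloor> / x - 1\<bar> < \<gamma> / 8"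
    using tendstoD[OF floor_over_self_tendsto, of "\<gamma> / 8"] gamma by (simp add: dist_real_def)
  have ev4: "\<forall>\<^sub>F x in at_top. smooth_density \<theta> x > dickman_rho (1 / \<theta>) - \<epsilon> / 2"
    using e by (intro order_tendstoD(1)[OF smooth_density_tendsto_dickman_rho[OF theta(1)]]) auto
  have "\<forall>\<^sub>F x in at_top. x > 1 \<and> LG_set (LG_N (\<delta> \<epsilon>) x) \<epsilon> (c \<epsilon>) x \<and>
      x powr (- c \<epsilon>) < \<epsilon> / 2 \<and> x powr (c \<epsilon> - 1) < 1 / 2 \<and>
      \<bar>of_int \<lfloor>x\<rfloor> / x - 1\<bar> < \<gamma> / 8 \<and> smooth_density \<theta> x > dickman_rho (1 / \<theta>) - \<epsilon> / 2"
    by (intro eventually_conj eventually_gt_at_top evLG ev1 ev2 ev3 ev4)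
  thus ?thesis
    apply (intro exI[of _ \<epsilon>] conjI e)
    apply (erule eventually_mono)
    apply (intro allI impI)
    subgoal premises prems for x w
    proof -
      from prems(1) have x: "x > 1" "LG_set (LG_N (\<delta> \<epsilon>) x) \<epsilon> (c \<epsilon>) x"
        "x powr (- c \<epsilon>) \<le> \<epsilon> / 2" "x powr (c \<epsilon> - 1) < 1 / 2"
        "\<bar>of_int \<lfloor>x\<rfloor> / x - 1\<bar> < \<gamma> / 8" "smooth_density \<theta> x > dickman_rho (1 / \<theta>) - \<epsilon> / 2"
        by auto
      note bounds = weighted_smooth_sum_bounds[where w = w,
          OF x(2,1) prems(2)[rule_format] e(4) gamma x(3-6) e(1)]
      show ?thesis unfolding Let_def using bounds by blast
    qed
    done
qed

end
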